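(* Let $K\subseteq\mathbb C$ be compact and $\varphi\in C(K,\mathbb C)$. The following assertions are equivalent: (1) $\varphi$ is a generator for $C(K,\mathbb C)$; that is, $C(K,\mathbb C)=[\varphi]_{\rm alg}$; (2) $\varphi$ is a homeomorphism of $K$ onto $\varphi(K)$, $K^\circ=\emptyset$ and $\mathbb C\setminus K$ is connected.
   Context: $C(K,\mathbb C)$ is the Banach algebra of complex-valued continuous functions on $K$ with the supremum norm. $[\varphi]_{\rm alg}$ denotes the closed subalgebra generated by $\varphi$, i.e. the uniform closure on $K$ of $\{p\circ\varphi: p\in\mathbb C[z]\}$ (constants included). $K^\circ$ is the interior of $K$ in $\mathbb C$. *)

theory Defs
  imports "HOL-Analysis.Analysis" "HOL-Computational_Algebra.Polynomial"
begin

text \<open>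
  Elements of \<open>C(K)\<close> are extensional (\<open>undefined\<close> outside \<open>K\<close>), so that equality of functions
  means equality on \<open>K\<close>. For compact \<open>K\<close> the boundedness built into \<^const>\<open>cfunspace\<close> is
  automatic, and its metric is the one induced by the supremum norm.
\<close>
definition CK :: "complex set \<Rightarrow> (complex \<Rightarrow> complex) metric"
  where "CK K = cfunspace (top_of_set K) euclidean_metric"

definition closed_subalgebra_gen :: "complex set \<Rightarrow> (complex \<Rightarrow> complex) \<Rightarrow> (complex \<Rightarrow> complex) set"
  where "closed_subalgebra_gen K \<phi> =
    mtopology_of (CK K) closure_of {restrict (poly p \<circ> \<phi>) K | p. True}"

lemma mspace_CK:
  assumes "compact K"
  shows "mspace (CK K) = {f \<in> extensional K. continuous_on K f}"
proof -
  have "bounded (f ` K)" if "continuous_on K f" for f :: "complex \<Rightarrow> complex"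
    using that assms by (simp add: compact_continuous_image compact_imp_bounded)
  moreover have "Metric_space.mbounded UNIV dist S \<longleftrightarrow> bounded S" for S :: "complex set"
    by simp
  ultimately show ?thesis
    by (auto simp: CK_def)
qed

lemma mdist_CK:
  assumes "f \<in> mspace (CK K)" "g \<in> mspace (CK K)" "K \<noteq> {}"
  shows "mdist (CK K) f g = (SUP x\<in>K. norm (f x - g x))"
proof -
  have "f \<in> mspace (funspace K euclidean_metric)" "g \<in> mspace (funspace K euclidean_metric)"
    using assms cfunspace_subset_funspace[of "top_of_set K" euclidean_metric]
    by (auto simp: CK_def)
  with assms(3) show ?thesis
    unfolding CK_def mdist_cfunspace_eq_mdist_funspace
    by (simp add: Met_TC.fdist_def dist_norm)
qed

lemma closed_subalgebra_gen_iff: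
  assumes "compact K" "\<phi> \<in> mspace (CK K)"
  shows "f \<in> closed_subalgebra_gen K \<phi> \<longleftrightarrow>
    f \<in> mspace (CK K) \<and> (\<forall>e>0. \<exists>p. \<forall>x\<in>K. norm (f x - poly p (\<phi> x)) < e)"
proof -
  interpret M: Metric_space "mspace (CK K)" "mdist (CK K)"
    by simp
  let ?r = "\<lambda>p. restrict (poly p \<circ> \<phi>) K"
  have r: "?r p \<in> mspace (CK K)" for p
  proof -
    have "continuous_on K (poly p \<circ> \<phi>)"
      using assms by (auto simp: mspace_CK o_def intro!: continuous_intros)
    then show ?thesis
      using assms(1) by (simp add: mspace_CK)
  qed
  have lt: "mdist (CK K) f (?r p) < e \<longleftrightarrow> (\<forall>x\<in>K. norm (f x - poly p (\<phi> x)) < e)"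
    if "f \<in> mspace (CK K)" "e > 0" for p e
  proof (cases "K = {}")
    case True
    then show ?thesis
      using that by (simp add: CK_def mdist_cfunspace_eq_mdist_funspace)
  next
    case False
    have c: "compact ((\<lambda>x. norm (f x - ?r p x)) ` K)"
      using that(1) r[of p] assms(1)
      by (intro compact_continuous_image continuous_intros) (auto simp: mspace_CK)
    obtain x where "x \<in> K" "(SUP x\<in>K. norm (f x - ?r p x)) = norm (f x - ?r p x)"
      using closed_contains_Sup[OF _ bounded_imp_bdd_above[OF compact_imp_bounded[OF c]]
          compact_imp_closed[OF c]] False by auto
    moreover have "norm (f y - ?r p y) \<le> (SUP x\<in>K. norm (f x - ?r p x))" if "y \<in> K" for y
      using that bounded_imp_bdd_above[OF compact_imp_bounded[OF c]] by (rule cSUP_upper)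
    ultimately show ?thesis
      unfolding mdist_CK[OF that(1) r False] by fastforce
  qed
  have "f \<in> closed_subalgebra_gen K \<phi> \<longleftrightarrow>
    f \<in> mspace (CK K) \<and> (\<forall>e>0. \<exists>p. mdist (CK K) f (?r p) < e)"
    using r unfolding closed_subalgebra_gen_def mtopology_of_def M.metric_closure_of
    by (simp add: M.in_mball) blast
  with lt show ?thesis
    by auto
qed

end

theory Submission imports Defs "HOL-Complex_Analysis.Complex_Analysis" "HOL-Real_Asymp.Real_Asymp"
begin

text \<open>
  Writing \<open>L = \<phi> ` K\<close>, condition (1) says that the polynomials are dense in \<open>C(L)\<close>. This forces
  \<open>L\<close> to have no interior (\<open>cnj\<close> is not holomorphic) and a connected complement (maximum
  principle), and \<open>\<phi>\<close> to be injective; these properties of \<open>L\<close> pass to the homeomorphic set \<open>K\<close>.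
  Conversely one needs Lavrentiev's theorem. By Stone--Weierstrass it suffices to approximate
  \<open>Im z\<close> by polynomials.

  Since \<open>lattice_row w = 1 / (1 - exp (2 \<pi> \<i> w))\<close> tends to \<open>1\<close>
  in the upper and to \<open>0\<close> in the lower half plane, a sum of \<open>lattice_row (w -
  \<i> n)\<close> over \<open>\<bar>n\<bar> \<le> N\<close> differs from \<open>Im w + N\<close>
  only by a logarithmic error and the contribution of the pole nearest to \<open>w\<close>. Put
  \<open>w = z / \<delta> - t\<close>, where the shift \<open>t\<close> keeps the lattice of
  poles off \<open>L\<close>. As \<open>- L\<close> is connected, each pole can be joined to a
  point at distance \<open>\<delta>\<close> outside \<open>L\<close>, and a square root branched
  at these two points yields a substitute for \<open>\<delta> / (z - c)\<close> that is bounded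
  by a constant and has an error \<open>O((\<delta> / \<bar>z - c\<bar>)\<^sup>2)\<close> far
  away. Substituting all poles costs \<open>O(log\<^sup>2 (1 / \<delta>))\<close>, which the
  scaling by \<open>\<delta>\<close> turns into \<open>o(1)\<close>.
\<close>

section \<open>Uniform limits of polynomials\<close>

text \<open>Only values on \<open>K\<close> matter, so members are total functions and
  \<open>poly_closure_cong\<close> takes the place of restriction to \<open>K\<close>.\<close>

definition poly_closure :: "complex set \<Rightarrow> (complex \<Rightarrow> complex) set"
  where "poly_closure K = {f. \<forall>e>0. \<exists>p. \<forall>z\<in>K. norm (f z - poly p z) < e}"

lemma poly_in_poly_closure: "poly p \<in> poly_closure K"
  unfolding poly_closure_def by (auto intro!: exI[of _ p])

lemma poly_closure_cong:
  assumes "f \<in> poly_closure K" "\<And>z. z \<in> K \<Longrightarrow> f z = g z"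
  shows "g \<in> poly_closure K"
  using assms unfolding poly_closure_def by auto

lemma const_in_poly_closure: "(\<lambda>z. c) \<in> poly_closure K"
  by (rule poly_closure_cong[OF poly_in_poly_closure[of "[:c:]"]]) simp

lemma ident_in_poly_closure: "(\<lambda>z. z) \<in> poly_closure K"
  by (rule poly_closure_cong[OF poly_in_poly_closure[of "[:0, 1:]"]]) simp

lemma poly_closureE:
  assumes "f \<in> poly_closure K" "e > 0"
  obtains p where "\<And>z. z \<in> K \<Longrightarrow> norm (f z - poly p z) < e"
  using assms unfolding poly_closure_def by blast

lemma poly_closure_limit:
  assumes "\<And>e. e > 0 \<Longrightarrow> \<exists>g\<in>poly_closure K. \<forall>z\<in>K. norm (f z - g z) < e"
  shows "f \<in> poly_closure K"
  unfolding poly_closure_def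
proof (intro CollectI allI impI)
  fix e :: real assume "e > 0"
  then obtain g where g: "g \<in> poly_closure K" "\<forall>z\<in>K. norm (f z - g z) < e / 2"
    using assms[of "e / 2"] by auto
  then obtain p where p: "\<And>z. z \<in> K \<Longrightarrow> norm (g z - poly p z) < e / 2"
    using \<open>e > 0\<close> poly_closureE[of g K "e / 2"] by auto
  have "norm (f z - poly p z) < e" if "z \<in> K" for z
    using norm_triangle_ineq[of "f z - g z" "g z - poly p z"] g(2) p that by fastforce
  then show "\<exists>p. \<forall>z\<in>K. norm (f z - poly p z) < e" by blast
qed

lemma poly_closure_add:
  assumes "f \<in> poly_closure K" "g \<in> poly_closure K"
  shows "(\<lambda>z. f z + g z) \<in> poly_closure K"
  unfolding poly_closure_def
proof (intro CollectI allI impI)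
  fix e :: real assume "e > 0"
  then have "e / 2 > 0" by simp
  then obtain p q where p: "\<And>z. z \<in> K \<Longrightarrow> norm (f z - poly p z) < e / 2"
    and q: "\<And>z. z \<in> K \<Longrightarrow> norm (g z - poly q z) < e / 2"
    using poly_closureE assms by metis
  have "norm (f z + g z - poly (p + q) z) < e" if "z \<in> K" for z
    using norm_triangle_ineq[of "f z - poly p z" "g z - poly q z"] p q that
    by (fastforce simp: algebra_simps)
  then show "\<exists>p. \<forall>z\<in>K. norm (f z + g z - poly p z) < e" by blast
qed

lemma poly_closure_bounded:
  assumes "compact K" "f \<in> poly_closure K"
  obtains B where "B > 0" "\<And>z. z \<in> K \<Longrightarrow> norm (f z) \<le> B"
proof -
  obtain p where p: "\<And>z. z \<in> K \<Longrightarrow> norm (f z - poly p z) < 1"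
    using poly_closureE[OF assms(2) zero_less_one] by blast
  have "bounded (poly p ` K)"
    by (intro compact_imp_bounded compact_continuous_image assms continuous_intros)
  then obtain B where "B > 0" "\<And>z. z \<in> K \<Longrightarrow> norm (poly p z) \<le> B"
    by (auto simp: bounded_pos)
  moreover have "norm (f z) \<le> norm (f z - poly p z) + norm (poly p z)" for z
    using norm_triangle_ineq[of "f z - poly p z" "poly p z"] by simp
  ultimately show ?thesis
    using p by (intro that[of "B + 1"]) (auto, smt (verit))
qed

lemma poly_closure_mult:
  assumes "compact K" "f \<in> poly_closure K" "g \<in> poly_closure K"
  shows "(\<lambda>z. f z * g z) \<in> poly_closure K"
  unfolding poly_closure_def
proof (intro CollectI allI impI)
  fix e :: real assume e: "e > 0"
  obtain B where B: "B > 0" "\<And>z. z \<in> K \<Longrightarrow> norm (f z) \<le> B"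
    using poly_closure_bounded assms by metis
  obtain q where q: "\<And>z. z \<in> K \<Longrightarrow> norm (g z - poly q z) < e / (2 * B)"
    using poly_closureE[OF assms(3), of "e / (2 * B)"] e B(1) by auto
  obtain C where C: "C > 0" "\<And>z. z \<in> K \<Longrightarrow> norm (poly q z) \<le> C"
    using poly_closure_bounded[OF assms(1) poly_in_poly_closure[of q]] by metis
  obtain p where p: "\<And>z. z \<in> K \<Longrightarrow> norm (f z - poly p z) < e / (2 * C)"
    using poly_closureE[OF assms(2), of "e / (2 * C)"] e C(1) by auto
  have "norm (f z * g z - poly (p * q) z) < e" if z: "z \<in> K" for z
  proof -
    have "norm (f z * g z - poly (p * q) z)
        = norm (f z * (g z - poly q z) + (f z - poly p z) * poly q z)"
      by (simp add: algebra_simps)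
    also have "\<dots> \<le> norm (f z) * norm (g z - poly q z) + norm (f z - poly p z) * norm (poly q z)"
      by (metis norm_mult norm_triangle_ineq)
    also have "\<dots> \<le> B * norm (g z - poly q z) + norm (f z - poly p z) * C"
      using B C z by (intro add_mono mult_mono) auto
    also have "\<dots> < B * (e / (2 * B)) + e / (2 * C) * C"
      using B(1) C(1) p q z by (intro add_strict_mono mult_strict_left_mono mult_strict_right_mono) auto
    also have "\<dots> = e" using B(1) C(1) by (simp add: field_simps)
    finally show ?thesis .
  qed
  then show "\<exists>p. \<forall>z\<in>K. norm (f z * g z - poly p z) < e" by blast
qed

lemma poly_closure_cmult:
  assumes "compact K" "f \<in> poly_closure K"
  shows "(\<lambda>z. c * f z) \<in> poly_closure K"
  by (intro poly_closure_mult assms const_in_poly_closure)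

lemma poly_closure_diff:
  assumes "compact K" "f \<in> poly_closure K" "g \<in> poly_closure K"
  shows "(\<lambda>z. f z - g z) \<in> poly_closure K"
  using poly_closure_add[OF assms(2) poly_closure_cmult[OF assms(1,3), of "-1"]] by simp

lemma poly_closure_sum:
  assumes "\<And>i. i \<in> I \<Longrightarrow> f i \<in> poly_closure K"
  shows "(\<lambda>z. \<Sum>i\<in>I. f i z) \<in> poly_closure K"
  using assms
  by (induction I rule: infinite_finite_induct)
     (auto intro: const_in_poly_closure poly_closure_add)

lemma poly_closure_prod:
  assumes "compact K" "\<And>i. i \<in> I \<Longrightarrow> f i \<in> poly_closure K"
  shows "(\<lambda>z. \<Prod>i\<in>I. f i z) \<in> poly_closure K"
  using assms(2)
  by (induction I rule: infinite_finite_induct)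
     (auto intro: const_in_poly_closure poly_closure_mult assms(1))

lemma poly_closure_power:
  assumes "compact K" "f \<in> poly_closure K"
  shows "(\<lambda>z. f z ^ n) \<in> poly_closure K"
  by (induction n) (auto intro: const_in_poly_closure poly_closure_mult assms)

lemma poly_closure_holomorphic_compose:
  assumes K: "compact K" and f: "f \<in> poly_closure K" and F: "F holomorphic_on ball \<xi> R"
    and r: "r < R" "\<And>z. z \<in> K \<Longrightarrow> norm (f z - \<xi>) \<le> r"
  shows "(\<lambda>z. F (f z)) \<in> poly_closure K"
proof (rule poly_closure_limit)
  fix e :: real assume e: "e > 0"
  define a where "a n = (deriv ^^ n) F \<xi> / fact n" for n
  have sums: "(\<lambda>n. a n * (w - \<xi>) ^ n) sums F w" if "w \<in> ball \<xi> R" for w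
    using holomorphic_power_series[OF F that] by (simp add: a_def)
  \<comment> \<open>Convergence at the intermediate radius \<open>r'\<close> makes the radius of
    convergence strictly larger than \<open>r\<close>. The maximum with 0 covers negative
    \<open>r\<close>.\<close>
  obtain r' where r': "r < r'" "0 < r'" "r' < R" if "0 < R"
    using r(1) dense[of "max r 0" R] by (cases "0 < R") auto
  have "\<exists>N. \<forall>w\<in>cball \<xi> r. norm (F w - (\<Sum>i<N. a i * (w - \<xi>) ^ i)) < e"
  proof (cases "0 < R")
    case False
    with r(1) show ?thesis by auto
  next
    case True
    note r' = r'[OF this]
    have "summable (\<lambda>n. a n * (of_real r') ^ n)"
      using sums[of "\<xi> + of_real r'"] r' by (auto simp: dist_norm sums_iff)
    then have "ereal r' \<le> conv_radius a"
      using conv_radius_geI[of a "of_real r'"] r' by simp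
    then have "ereal r < conv_radius a"
      using r'(1) by (metis ereal_less_eq(3) less_eq_ereal_def less_ereal.simps(1) order.strict_trans1 order_less_le_trans)
    then have "uniform_limit (cball \<xi> r) (\<lambda>n x. \<Sum>i<n. a i * (x - \<xi>) ^ i)
        (\<lambda>x. \<Sum>i. a i * (x - \<xi>) ^ i) sequentially"
      by (rule powser_uniform_limit)
    then obtain N where "\<forall>w\<in>cball \<xi> r. dist (\<Sum>i<N. a i * (w - \<xi>) ^ i) (\<Sum>i. a i * (w - \<xi>) ^ i) < e"
      using e unfolding uniform_limit_iff eventually_sequentially by blast
    moreover have "(\<Sum>i. a i * (w - \<xi>) ^ i) = F w" if "w \<in> cball \<xi> r" for w
      using sums[of w] that r(1) by (auto simp: sums_iff)
    ultimately show ?thesis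
      by (auto intro!: exI[of _ N] simp: dist_norm norm_minus_commute)
  qed
  then obtain N where N: "\<forall>w\<in>cball \<xi> r. norm (F w - (\<Sum>i<N. a i * (w - \<xi>) ^ i)) < e" by blast
  show "\<exists>g\<in>poly_closure K. \<forall>z\<in>K. norm (F (f z) - g z) < e"
    using N r(2)
    by (intro bexI[of _ "\<lambda>z. \<Sum>i<N. a i * (f z - \<xi>) ^ i"] poly_closure_sum poly_closure_cmult
        poly_closure_power poly_closure_diff f const_in_poly_closure K)
      (auto simp: dist_norm norm_minus_commute)
qed

lemma holomorphic_in_poly_closure:
  assumes "compact K" "K \<subseteq> cball \<xi> r" "r < R" "F holomorphic_on ball \<xi> R"
  shows "F \<in> poly_closure K"
  using poly_closure_holomorphic_compose[OF assms(1) ident_in_poly_closure assms(4,3)] assms(2)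
  by (auto simp: dist_norm norm_minus_commute subset_iff)

text \<open>This is the form used below, with \<open>inverse\<close> and \<open>csqrt\<close> for
  \<open>F\<close> and a uniformly small perturbation \<open>f\<close> of 1.\<close>

lemma poly_closure_compose_one_plus:
  assumes K: "compact K" and f: "f \<in> poly_closure K" and F: "F holomorphic_on ball 1 1"
    and r: "r < 1" "\<And>z. z \<in> K \<Longrightarrow> norm (f z) \<le> r"
  shows "(\<lambda>z. F (1 + f z)) \<in> poly_closure K"
  by (rule poly_closure_holomorphic_compose[OF K _ F r(1)])
     (use r f in \<open>auto intro: poly_closure_add const_in_poly_closure\<close>)

text \<open>The set of admissible poles is open and closed in the complement of \<open>K\<close>.\<close>
lemma inverse_in_poly_closure:
  assumes K: "compact K" and con: "connected (- K)" and a: "a \<notin> K"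
  shows "(\<lambda>z. 1 / (z - a)) \<in> poly_closure K"
proof -
  let ?P = "\<lambda>a. (\<lambda>z. 1 / (z - a)) \<in> poly_closure K"
  have inv: "inverse holomorphic_on ball (1::complex) 1"
    by (intro holomorphic_intros) auto
  \<comment> \<open>Since z - b = (z - a)(1 + (a - b)/(z - a)), a geometric series moves the pole
    from \<open>a\<close> to \<open>b\<close> when \<open>b\<close> is closer to \<open>a\<close>
    than \<open>K\<close> is, by a factor \<open>s < 1\<close>.\<close>
  have step: "?P b" if P: "?P a" and ab: "b \<notin> K" "s < 1" "\<And>z. z \<in> K \<Longrightarrow> norm (b - a) \<le> s * norm (z - a)"
    and a: "a \<notin> K" for a b s
  proof -
    let ?f = "\<lambda>z. (a - b) * (1 / (z - a))"
    have "?f \<in> poly_closure K" by (intro poly_closure_cmult K P)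
    moreover have "norm (?f z) \<le> s" if "z \<in> K" for z
      using ab(3)[OF that] a that by (auto simp: norm_mult norm_divide divide_simps norm_minus_commute)
    ultimately have "(\<lambda>z. inverse (1 + ?f z)) \<in> poly_closure K"
      by (rule poly_closure_compose_one_plus[OF K _ inv ab(2)])
    then have "(\<lambda>z. 1 / (z - a) * inverse (1 + ?f z)) \<in> poly_closure K"
      by (intro poly_closure_mult K P)
    then show ?thesis
      by (rule poly_closure_cong) (use a ab in \<open>auto simp: divide_simps; auto simp: algebra_simps\<close>)
  qed
  obtain B where B: "B > 0" "\<And>z. z \<in> K \<Longrightarrow> norm z \<le> B"
    using compact_imp_bounded[OF K] by (auto simp: bounded_pos)
  \<comment> \<open>A starting pole so far out that |z / a0| is at most 1/2 on
    \<open>K\<close>.\<close>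
  define a0 where "a0 = complex_of_real (2 * B)"
  have "?P a0 \<and> a0 \<notin> K"
  proof
    show "a0 \<notin> K" using B by (force simp: a0_def)
    have "(\<lambda>z. - (1 / a0) * inverse (1 + (- (1 / a0)) * z)) \<in> poly_closure K"
      using B by (intro poly_closure_mult K const_in_poly_closure poly_closure_compose_one_plus[of K _ inverse "1/2"]
          poly_closure_cmult ident_in_poly_closure inv)
        (auto simp: a0_def norm_mult norm_divide field_simps)
    then show "?P a0"
      by (rule poly_closure_cong) (use B \<open>a0 \<notin> K\<close> in \<open>auto simp: a0_def divide_simps; auto simp: algebra_simps\<close>)
  qed
  moreover have "?P a0 \<longleftrightarrow> ?P a" if "a0 \<notin> K"
  proof (rule connected_equivalence_relation[OF con, where R = "\<lambda>x y. ?P x \<longleftrightarrow> ?P y"])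
    fix x assume "x \<in> - K"
    then obtain d where d: "d > 0" "\<And>z. z \<in> K \<Longrightarrow> d \<le> dist x z"
      using separate_point_closed[OF compact_imp_closed[OF K], of x] by auto
    have x: "x \<notin> K" using d by fastforce
    \<comment> \<open>Points of \<open>K\<close> are at distance at least d from \<open>x\<close>
      and 2d/3 from \<open>y\<close>, so the ratio 1/2 holds in both directions. Both are needed for
      a local equivalence.\<close>
    let ?T = "ball x (d / 3)"
    have T: "y \<notin> K" "norm (x - y) \<le> 1/2 * norm (z - x)" "norm (x - y) \<le> 1/2 * norm (z - y)"
      if "y \<in> ?T" "z \<in> K" for y z
    proof -
      show "y \<notin> K" using d(1) d(2)[of y] that by force
      show "norm (x - y) \<le> 1/2 * norm (z - x)" "norm (x - y) \<le> 1/2 * norm (z - y)"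
        using d(2)[of z] that norm_triangle_ineq[of "z - y" "y - x"] norm_ge_zero[of "x - y"]
        by (auto simp: dist_norm norm_minus_commute simp del: norm_ge_zero)
    qed
    have T': "y \<notin> K" if "y \<in> ?T" for y using T(1)[of y y] that by blast
    have "?P x \<longleftrightarrow> ?P y" if y: "y \<in> ?T" for y
      using step[of x y "1/2"] step[of y x "1/2"] T(2,3)[OF y] T'[OF y] x by (auto simp: norm_minus_commute)
    then show "\<exists>T. openin (top_of_set (- K)) T \<and> x \<in> T \<and> (\<forall>y\<in>T. ?P x \<longleftrightarrow> ?P y)"
      using d(1) K T' by (intro exI[of _ ?T]) (auto simp: openin_open_eq compact_imp_closed open_Compl)
  qed (use that a in auto)
  ultimately show ?thesis by blast
qed

section \<open>Bounded substitutes for simple poles\<close>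

text \<open>From t = (s - 1)(s + 1) and |s + 1| >= Re s + 1 > 1. It measures how close the selected
  branch is to 1.\<close>

lemma norm_sqrt_minus_one_le:
  fixes s t :: complex
  assumes "s\<^sup>2 = 1 + t" "Re s > 0"
  shows "norm (s - 1) \<le> norm t"
proof -
  have "norm (s + 1) \<ge> 1"
    using complex_Re_le_cmod[of "s + 1"] assms(2) by simp
  moreover have "t = (s - 1) * (s + 1)"
    using assms(1) by (simp add: algebra_simps power2_eq_square)
  ultimately show ?thesis
    using mult_left_mono[of 1 "norm (s + 1)" "norm (s - 1)"] by (simp add: norm_mult)
qed

lemma Re_mult_pos_near_one:
  fixes s t :: complex
  assumes "norm (s - 1) \<le> 1/4" "norm (t - 1) \<le> 1/4"
  shows "Re (s * t) > 0"
proof -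
  have "norm (s * t - 1) = norm ((s - 1) * (t - 1) + (s - 1) + (t - 1))"
    by (simp add: algebra_simps)
  also have "\<dots> \<le> norm (s - 1) * norm (t - 1) + norm (s - 1) + norm (t - 1)"
    by (metis (no_types, opaque_lifting) add_mono_thms_linordered_semiring(3) norm_mult norm_triangle_ineq order_trans)
  also have "\<dots> \<le> 1/4 * (1/4) + 1/4 + 1/4"
    using assms by (intro add_mono mult_mono) auto
  finally have "norm (s * t - 1) < 1" by simp
  then show ?thesis
    using abs_Re_le_cmod[of "s * t - 1"] by simp
qed

lemma Re_csqrt_pos:
  assumes "Re z > 0"
  shows "Re (csqrt z) > 0"
proof (rule ccontr)
  assume "\<not> ?thesis"
  then have "Re (csqrt z) = 0" using csqrt_principal[of z] by auto
  then have "Re ((csqrt z)\<^sup>2) \<le> 0" by (simp add: power2_eq_square)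
  with assms show False by simp
qed

text \<open>A branch of the square root of \<open>(z - a) / (z - b)\<close> exists off any connected set joining
  \<open>a\<close> to \<open>b\<close>. The condition on the real part selects, far away from that set, the branch that
  tends to \<open>1\<close> at infinity.\<close>
lemma sqrt_quotient_in_poly_closure:
  assumes K: "compact K" "connected (- K)" and E: "connected E" "E \<subseteq> cball c d" "E \<inter> K = {}"
    and d: "d > 0" and ab: "a \<in> E" "b \<in> E"
  shows "\<exists>S\<in>poly_closure K. \<forall>z\<in>K. (S z)\<^sup>2 = (z - a) / (z - b) \<and>
    (9 * d \<le> norm (z - c) \<longrightarrow> Re (S z) > 0)"
\<comment> \<open>Admitting a branch is an equivalence relation on pairs of endpoints: reciprocals
  give symmetry and products transitivity. The principal root gives it locally, and connectedness of
  \<open>E\<close> does the rest.\<close>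
proof (rule connected_equivalence_relation[OF E(1) ab])
  let ?R = "\<lambda>a b. \<exists>S\<in>poly_closure K. \<forall>z\<in>K. (S z)\<^sup>2 = (z - a) / (z - b) \<and>
    (9 * d \<le> norm (z - c) \<longrightarrow> Re (S z) > 0)"
  have notin: "z \<noteq> x" if "z \<in> K" "x \<in> E" for x z using that E(3) by blast
  show "?R y x" if "?R x y" and xy: "x \<in> E" "y \<in> E" for x y
  proof -
    from \<open>?R x y\<close> obtain S where S: "S \<in> poly_closure K"
      "\<And>z. z \<in> K \<Longrightarrow> (S z)\<^sup>2 = (z - x) / (z - y)"
      "\<And>z. z \<in> K \<Longrightarrow> 9 * d \<le> norm (z - c) \<Longrightarrow> Re (S z) > 0" by blast
    \<comment> \<open>The second factor is (z - y)/(z - x), the reciprocal of the square of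
      \<open>S\<close>. Hence \<open>?T\<close> is 1/S, written without dividing by
      \<open>S\<close>.\<close>
    let ?T = "\<lambda>z. S z * (1 + (x - y) * (1 / (z - x)))"
    have quot: "1 + (x - y) * (1 / (z - x)) = (z - y) / (z - x)" if "z \<in> K" for z
      using notin[OF that xy(1)] by (simp add: divide_simps)
    have "?T \<in> poly_closure K"
      using xy E(3) by (intro poly_closure_mult poly_closure_add poly_closure_cmult
          const_in_poly_closure inverse_in_poly_closure S(1) K) auto
    moreover have "(?T z)\<^sup>2 = (z - y) / (z - x)" if "z \<in> K" for z
      using notin[OF that xy(1)] notin[OF that xy(2)]
      by (simp only: quot[OF that] power_mult_distrib S(2)[OF that]) (simp add: power2_eq_square)
    moreover have "Re (?T z) > 0" if z: "z \<in> K" "9 * d \<le> norm (z - c)" for z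
    proof -
      have "S z * ?T z = 1"
        using notin[OF z(1) xy(1)] notin[OF z(1) xy(2)] S(2)[OF z(1)]
        by (simp only: quot[OF z(1)] mult.assoc[symmetric] power2_eq_square[symmetric]) simp
      then have "?T z = inverse (S z)" by (simp add: inverse_unique)
      moreover have "Re (inverse (S z)) > 0"
        using S(3)[OF z] by (auto intro!: divide_pos_pos add_pos_nonneg)
      ultimately show ?thesis by metis
    qed
    ultimately show ?thesis by (intro bexI[of _ ?T]) auto
  qed
  show "?R x w" if "?R x y" "?R y w" and xyw: "x \<in> E" "y \<in> E" "w \<in> E" for x y w
  proof -
    from \<open>?R x y\<close> obtain S where S: "S \<in> poly_closure K"
      "\<And>z. z \<in> K \<Longrightarrow> (S z)\<^sup>2 = (z - x) / (z - y)"
      "\<And>z. z \<in> K \<Longrightarrow> 9 * d \<le> norm (z - c) \<Longrightarrow> Re (S z) > 0" by blast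
    from \<open>?R y w\<close> obtain T where T: "T \<in> poly_closure K"
      "\<And>z. z \<in> K \<Longrightarrow> (T z)\<^sup>2 = (z - y) / (z - w)"
      "\<And>z. z \<in> K \<Longrightarrow> 9 * d \<le> norm (z - c) \<Longrightarrow> Re (T z) > 0" by blast
    have near: "norm (s - 1) \<le> 1/4"
      if "s\<^sup>2 = (z - p) / (z - q)" "Re s > 0" "p \<in> E" "q \<in> E" "z \<in> K" "9 * d \<le> norm (z - c)" for s z p q
    proof -
      have "dist c p \<le> d" "dist c q \<le> d" using that E(2) by auto
      \<comment> \<open>This is the origin of the constant 9: at distance at least 9d from
        \<open>c\<close>, the quotient differs from 1 by at most 2d/(8d) = 1/4, so a product of two
        branches keeps positive real part.\<close>
      then have "norm (q - p) \<le> 2 * d" "norm (z - q) \<ge> 8 * d"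
        using that(6) dist_triangle[of q p c] dist_triangle[of z c q]
        by (auto simp: dist_norm norm_minus_commute)
      then have "norm ((q - p) / (z - q)) \<le> 1/4"
        using d by (simp add: norm_divide divide_simps)
      moreover have "s\<^sup>2 = 1 + (q - p) / (z - q)"
        using that(1) notin[OF that(5,4)] by (simp add: divide_simps)
      ultimately show ?thesis
        using norm_sqrt_minus_one_le that(2) by fastforce
    qed
    show ?thesis
    proof (intro bexI[of _ "\<lambda>z. S z * T z"] ballI conjI impI)
      show "(S z * T z)\<^sup>2 = (z - x) / (z - w)" if "z \<in> K" for z
        using S(2)[OF that] T(2)[OF that] notin[OF that xyw(2)] by (simp add: power_mult_distrib)
      show "Re (S z * T z) > 0" if "z \<in> K" "9 * d \<le> norm (z - c)" for z
        using near[OF S(2,3) xyw(1,2) that] near[OF T(2,3) xyw(2,3) that] that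
        by (intro Re_mult_pos_near_one) auto
    qed (intro poly_closure_mult K S T)
  qed
  fix x assume x: "x \<in> E"
  then obtain r where r: "r > 0" "\<And>z. z \<in> K \<Longrightarrow> r \<le> dist x z"
    using separate_point_closed[OF compact_imp_closed[OF K(1)], of x] E(3) by auto
  \<comment> \<open>Here the quotient stays within 1/2 of 1 on \<open>K\<close>, well inside the
    domain of \<open>csqrt\<close>.\<close>
  have "?R x y" if y: "y \<in> E" "dist x y < r / 4" for y
  proof -
    let ?t = "\<lambda>z. (y - x) * (1 / (z - y))"
    have t: "norm (?t z) \<le> 1/2" if "z \<in> K" for z
      using r(2)[OF that] y(2) r(1) notin[OF that y(1)] dist_triangle[of x z y]
      by (simp add: norm_mult norm_divide dist_norm norm_minus_commute divide_simps)
    have "csqrt holomorphic_on ball 1 1"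
    proof (rule holomorphic_on_subset[OF holomorphic_on_csqrt])
      have "Re z > 0" if "z \<in> ball 1 1" for z :: complex
        using that abs_Re_le_cmod[of "1 - z"] by (auto simp: dist_norm)
      then show "ball 1 1 \<subseteq> - (\<real>\<^sub>\<le>\<^sub>0 :: complex set)"
        by (force simp: complex_nonpos_Reals_iff)
    qed
    then have "(\<lambda>z. csqrt (1 + ?t z)) \<in> poly_closure K"
      using t y E(3)
      by (intro poly_closure_compose_one_plus[where r = "1/2"] poly_closure_cmult
          inverse_in_poly_closure K) auto
    moreover have "1 + ?t z = (z - x) / (z - y)" if "z \<in> K" for z
      using notin[OF that y(1)] by (simp add: divide_simps)
    moreover have "Re (csqrt (1 + ?t z)) > 0" if "z \<in> K" for z
      using t[OF that] abs_Re_le_cmod[of "?t z"] by (intro Re_csqrt_pos) (simp add: abs_le_iff)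
    ultimately show ?thesis
      by (intro bexI[of _ "\<lambda>z. csqrt (1 + ?t z)"]) auto
  qed
  then show "\<exists>T. openin (top_of_set E) T \<and> x \<in> T \<and> (\<forall>y\<in>T. ?R x y)"
    using r(1) x by (intro exI[of _ "E \<inter> ball x (r / 4)"]) (auto simp: openin_open_Int)
qed

text \<open>A path in the complement from \<open>c\<close> to a remote point must cross the sphere
  of radius \<open>d\<close>; the piece up to the first crossing serves as \<open>E\<close>.\<close>

lemma connected_escape:
  fixes K :: "complex set"
  assumes "compact K" "connected (- K)" "c \<notin> K" "d > 0"
  obtains E b where "connected E" "E \<subseteq> cball c d" "E \<inter> K = {}" "c \<in> E" "b \<in> E" "dist c b = d"
proof -
  obtain B where B: "B > 0" "\<And>z. z \<in> K \<Longrightarrow> norm z \<le> B"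
    using compact_imp_bounded[OF assms(1)] by (auto simp: bounded_pos)
  define q where "q = complex_of_real (B + norm c + d + 1)"
  have nq: "norm q = B + norm c + d + 1"
    unfolding q_def norm_of_real using B assms(4) by simp
  have "q \<notin> K" using B nq assms(4) by (smt (verit) norm_ge_zero)
  have "dist c q > d"
    using norm_triangle_ineq[of c "q - c"] nq B by (simp add: dist_norm norm_minus_commute)
  have "path_connected (- K)"
    using assms by (simp add: connected_open_path_connected compact_imp_closed open_Compl)
  then obtain g where g: "path g" "path_image g \<subseteq> - K" "pathstart g = c" "pathfinish g = q"
    using assms(3) \<open>q \<notin> K\<close> unfolding path_connected_def by (metis ComplI)
  obtain h where h: "path h" "pathstart h = pathstart g" "path_image h \<subseteq> path_image g \<inter> cball c d"
      "pathfinish h \<in> frontier (cball c d)"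
    using exists_path_subpath_to_frontier_closed[of "cball c d" g] g assms(4) \<open>dist c q > d\<close> by auto
  show ?thesis
  proof
    show "connected (path_image h)" using h(1) by (rule connected_path_image)
    show "c \<in> path_image h" using h(2) g(3) pathstart_in_path_image by metis
    show "dist c (pathfinish h) = d" using h(4) assms(4) by (simp add: frontier_cball)
  qed (use h g in auto)
qed

text \<open>With \<open>S\<^sup>2 = (z - c) / (z - b)\<close> and \<open>m = (b + c) / 2\<close>, the function \<open>z - m - (z - b) S\<close> is the
  inverse Joukowski map for the endpoints \<open>b\<close> and \<open>c\<close>; it behaves like
  \<open>(b - c)\<^sup>2 / (8 z)\<close> at infinity.\<close>
lemma bounded_pole_approximation:
  assumes K: "compact K" "connected (- K)" and c: "c \<notin> K" and d: "d > 0"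
  obtains g where "g \<in> poly_closure K"
    "\<And>z. z \<in> K \<Longrightarrow> norm (z - c) \<le> 9 * d \<Longrightarrow> norm (g z) \<le> 160 / d"
    "\<And>z. z \<in> K \<Longrightarrow> 9 * d \<le> norm (z - c) \<Longrightarrow> norm (g z - 1 / (z - c)) \<le> 160 * d / (norm (z - c))\<^sup>2"
proof -
  obtain E b where E: "connected E" "E \<subseteq> cball c d" "E \<inter> K = {}" "c \<in> E" "b \<in> E" "dist c b = d"
    using connected_escape[OF K c d] .
  obtain S where S: "S \<in> poly_closure K" "\<And>z. z \<in> K \<Longrightarrow> (S z)\<^sup>2 = (z - c) / (z - b)"
      "\<And>z. z \<in> K \<Longrightarrow> 9 * d \<le> norm (z - c) \<Longrightarrow> Re (S z) > 0"
    using sqrt_quotient_in_poly_closure[OF K E(1-3) d E(4,5)] by blast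
  have bc: "norm (b - c) = d" "b \<noteq> c" using E(6) d by (auto simp: dist_norm norm_minus_commute)
  define h where "h z = z - (b + c) / 2 - (z - b) * S z" for z
  \<comment> \<open>The factor normalises the leading term of \<open>h\<close> at infinity to 1/z.
    It also turns the bound 20d for \<open>h\<close> near \<open>c\<close> into 160/d.\<close>
  define g where "g z = 8 / (b - c)\<^sup>2 * h z" for z
  show ?thesis
  proof
    show "g \<in> poly_closure K"
      unfolding g_def h_def
      by (intro poly_closure_cmult poly_closure_diff poly_closure_mult K S ident_in_poly_closure
          const_in_poly_closure)
    show "norm (g z) \<le> 160 / d" if z: "z \<in> K" "norm (z - c) \<le> 9 * d" for z
    proof -
      have zb: "z \<noteq> b" "norm (z - b) \<le> 10 * d"
        using z E(3,5) norm_triangle_ineq[of "z - c" "c - b"] bc(1) by (auto simp: norm_minus_commute)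
      \<comment> \<open>\<open>S\<close> alone has no uniform bound near \<open>b\<close>; the
        factor z - b cancels the singularity.\<close>
      have "((z - b) * S z)\<^sup>2 = (z - b) * (z - c)"
        using zb by (simp only: power_mult_distrib S(2)[OF z(1)]) (simp add: power2_eq_square)
      then have "(norm ((z - b) * S z))\<^sup>2 = norm (z - b) * norm (z - c)"
        by (metis norm_mult norm_power)
      also have "\<dots> \<le> (10 * d) * (10 * d)"
        using zb z d by (intro mult_mono) auto
      finally have "(norm ((z - b) * S z))\<^sup>2 \<le> (10 * d)\<^sup>2"
        by (simp only: power2_eq_square)
      then have "norm ((z - b) * S z) \<le> 10 * d"
        by (rule power2_le_imp_le) (use d in simp)
      moreover have "norm (z - (b + c) / 2) \<le> 10 * d"
      proof -
        have "z - (b + c) / 2 = (z - c) - (b - c) / 2" by (simp add: field_simps)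
        then have "norm (z - (b + c) / 2) \<le> norm (z - c) + norm ((b - c) / 2)"
          by (metis norm_triangle_ineq4)
        then show ?thesis using z bc d by (simp add: norm_divide)
      qed
      ultimately have "norm (h z) \<le> 20 * d"
        unfolding h_def using norm_triangle_ineq4[of "z - (b + c) / 2" "(z - b) * S z"] by linarith
      then show ?thesis
        using d bc by (simp add: g_def norm_mult norm_divide norm_power divide_simps power2_eq_square)
    qed
    show "norm (g z - 1 / (z - c)) \<le> 160 * d / (norm (z - c))\<^sup>2" if z: "z \<in> K" "9 * d \<le> norm (z - c)" for z
    proof -
      \<comment> \<open>In this variable S^2 = 1 + t and h = (z - b)(1 + t/2 - S). Multiplying by
        the conjugate factor \<open>?w\<close> leaves t^2/4, so g = 2/((z - b) ?w) with
        \<open>?w\<close> close to 2.\<close>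
      define t where "t = (b - c) / (z - b)"
      let ?w = "1 + t / 2 + S z"
      have zb: "norm (z - b) \<ge> 8 / 9 * norm (z - c)" "z \<noteq> b" "z \<noteq> c"
        using z E(3,5) norm_triangle_ineq[of "z - b" "b - c"] bc(1) c by auto
      have zb': "norm (z - b) \<ge> 8 * d" using zb z by linarith
      then have nt: "norm t \<le> 1 / 8" "norm t = d / norm (z - b)"
        using d bc by (auto simp: t_def norm_divide divide_simps)
      have "(S z)\<^sup>2 = 1 + t"
        using S(2)[OF z(1)] zb by (simp add: t_def divide_simps)
      note St = this norm_sqrt_minus_one_le[OF this S(3)[OF z]]
      have "Re ?w \<ge> 1 / 2"
        using nt(1) abs_Re_le_cmod[of t] S(3)[OF z] by (auto simp: abs_le_iff)
      then have w: "norm ?w \<ge> 1 / 2" "?w \<noteq> 0"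
        using complex_Re_le_cmod[of ?w] by auto
      have h: "h z = (z - b) * (1 + t / 2 - S z)"
        using zb by (simp add: h_def t_def field_simps)
      have "(1 + t / 2 - S z) * ?w = (1 + t / 2)\<^sup>2 - (S z)\<^sup>2"
        by (simp add: algebra_simps power2_eq_square)
      also have "\<dots> = t\<^sup>2 / 4"
        unfolding St(1) by (simp add: power2_eq_square field_simps)
      finally have "h z * ?w * (z - b) = (z - b)\<^sup>2 * (t\<^sup>2 / 4)"
        unfolding h by (simp add: power2_eq_square mult_ac)
      also have "\<dots> = (b - c)\<^sup>2 / 4"
        using zb by (simp add: t_def power_divide)
      finally have "h z * ?w * (z - b) = (b - c)\<^sup>2 / 4" .
      moreover have nz: "(z - b) * ?w \<noteq> 0" using zb w by simp
      ultimately have "h z = (b - c)\<^sup>2 / 4 / ((z - b) * ?w)"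
        by (simp only: nonzero_eq_divide_eq[OF nz]) (simp add: mult_ac)
      then have "g z = 2 / ((z - b) * ?w)"
        using bc by (simp add: g_def)
      moreover have "1 / (z - b) = ?w / ((z - b) * ?w)"
        using w by simp
      moreover have "1 - t / 2 - S z = 2 - ?w" by simp
      ultimately have "g z - 1 / (z - b) = (1 - t / 2 - S z) / ((z - b) * ?w)"
        by (simp only: diff_divide_distrib)
      also have "norm \<dots> \<le> (3 / 2 * norm t) / (norm (z - b) * (1 / 2))"
        unfolding norm_divide norm_mult
      proof (intro frac_le mult_mono)
        show "norm (1 - t / 2 - S z) \<le> 3 / 2 * norm t"
          using norm_triangle_ineq4[of "1 - S z" "t / 2"] St(2)
          by (simp add: norm_minus_commute algebra_simps)
      qed (use w zb in auto)
      also have "\<dots> = 3 * d / (norm (z - b))\<^sup>2"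
        using nt(2) by (simp add: power2_eq_square)
      also have "\<dots> \<le> 3 * d / (8 / 9 * norm (z - c))\<^sup>2"
        using zb d by (intro divide_left_mono power_mono mult_pos_pos) auto
      also have "\<dots> \<le> 4 * d / (norm (z - c))\<^sup>2"
        using zb d by (simp add: power_mult_distrib divide_simps power2_eq_square)
      finally have 1: "norm (g z - 1 / (z - b)) \<le> 4 * d / (norm (z - c))\<^sup>2" .
      \<comment> \<open>So far \<open>g\<close> has been compared with the pole at \<open>b\<close>;
        moving that pole to \<open>c\<close> costs an error of the same order.\<close>
      have "1 / (z - b) - 1 / (z - c) = (b - c) / ((z - b) * (z - c))"
        using zb by (simp add: divide_simps)
      then have "norm (1 / (z - b) - 1 / (z - c)) = d / (norm (z - b) * norm (z - c))"
        using bc by (simp add: norm_divide norm_mult)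
      also have "\<dots> \<le> d / (8 / 9 * norm (z - c) * norm (z - c))"
        using zb d by (intro divide_left_mono mult_right_mono mult_pos_pos) auto
      also have "\<dots> \<le> 2 * d / (norm (z - c))\<^sup>2"
        using zb d by (simp add: power_mult_distrib divide_simps power2_eq_square)
      finally have 2: "norm (1 / (z - b) - 1 / (z - c)) \<le> 2 * d / (norm (z - c))\<^sup>2" .
      have "norm (g z - 1 / (z - c)) \<le> 6 * (d / (norm (z - c))\<^sup>2)"
        using norm_triangle_ineq[of "g z - 1 / (z - b)" "1 / (z - b) - 1 / (z - c)"] 1 2 by simp
      also have "\<dots> \<le> 160 * (d / (norm (z - c))\<^sup>2)"
        using d by (intro mult_right_mono) auto
      finally show ?thesis by simp
    qed
  qed
qed

section \<open>Lattice sums\<close>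

text \<open>Equal to 1/2 + (\<i>/2) cot(pi w): period 1, with simple poles exactly at the integers,
  each of residue \<open>\<i> / (2 * pi)\<close>.\<close>

definition lattice_row :: "complex \<Rightarrow> complex"
  where "lattice_row w = 1 / (1 - exp (2 * pi * \<i> * w))"

lemma lattice_row_minus_of_int: "lattice_row (w - of_int m) = lattice_row w"
proof -
  have "exp (2 * pi * \<i> * (w - of_int m)) = exp (2 * pi * \<i> * w) / exp (2 * of_int m * pi * \<i>)"
    by (simp only: exp_diff[symmetric]) (simp add: algebra_simps)
  also have "exp (2 * of_int m * pi * \<i>) = 1"
    using exp_integer_2pi[of "of_int m"] by simp
  finally show ?thesis by (simp add: lattice_row_def)
qed

text \<open>The decay is exponential, but the reciprocal bound is the one that matches the later
  harmonic sums.\<close>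

lemma lattice_row_upper:
  assumes "Im w > 0"
  shows "norm (lattice_row w - 1) \<le> 1 / Im w"
proof -
  define E where "E = exp (2 * pi * \<i> * w)"
  define x where "x = 2 * pi * Im w"
  have x: "x > 0" "Im w \<le> x"
    using assms pi_ge_two by (auto simp: x_def)
  have nE: "norm E = exp (- x)" by (simp add: E_def x_def)
  then have "norm E < 1" using x by simp
  then have "E \<noteq> 1" by auto
  then have "lattice_row w - 1 = E / (1 - E)"
    unfolding lattice_row_def E_def[symmetric] by (simp add: divide_simps)
  then have "norm (lattice_row w - 1) = exp (- x) / norm (1 - E)"
    by (simp add: norm_divide nE)
  also have "\<dots> \<le> exp (- x) / (1 - exp (- x))"
    using norm_triangle_ineq2[of 1 E] nE x by (intro divide_left_mono mult_pos_pos) auto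
  also have "\<dots> = 1 / (exp x - 1)"
    using x by (simp add: exp_minus field_simps)
  also have "\<dots> \<le> 1 / Im w"
    using exp_ge_add_one_self[of x] x assms by (intro divide_left_mono mult_pos_pos; linarith)
  finally show ?thesis .
qed

lemma lattice_row_lower:
  assumes "Im w < 0"
  shows "norm (lattice_row w) \<le> 1 / \<bar>Im w\<bar>"
proof -
  define E where "E = exp (2 * pi * \<i> * w)"
  define x where "x = 2 * pi * \<bar>Im w\<bar>"
  have x: "x > 0" "\<bar>Im w\<bar> \<le> x"
    using assms pi_ge_two mult_right_mono[of 1 "2 * pi" "\<bar>Im w\<bar>"] by (auto simp: x_def mult_pos_neg)
  have nE: "norm E = exp x" using assms by (simp add: E_def x_def)
  have "norm (lattice_row w) = 1 / norm (1 - E)"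
    unfolding lattice_row_def E_def[symmetric] by (simp add: norm_divide)
  also have "\<dots> \<le> 1 / \<bar>Im w\<bar>"
  proof (intro divide_left_mono mult_pos_pos)
    show "\<bar>Im w\<bar> \<le> norm (1 - E)"
      using norm_triangle_ineq2[of E 1] exp_ge_add_one_self[of x] x(2)
      by (simp only: norm_minus_commute nE norm_one)
    then show "0 < norm (1 - E)" using assms by linarith
  qed (use assms in auto)
  finally show ?thesis .
qed

text \<open>Subtracting the principal part at 0 removes the only pole in the unit square.
  Compactness bounds the difference away from 0, and a Taylor estimate bounds it near 0.\<close>

lemma lattice_row_near_pole:
  "\<exists>C>0. \<forall>w. \<bar>Re w\<bar> \<le> 1/2 \<longrightarrow> \<bar>Im w\<bar> \<le> 1/2 \<longrightarrow> w \<noteq> 0 \<longrightarrow>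
    norm (lattice_row w - \<i> / (2 * pi) / w) \<le> C"
proof -
  \<comment> \<open>The radius 1/(4 pi) makes |2 pi \<i> w| at most 1/2 on the removed disc.\<close>
  define Z where "Z = cbox (Complex (-1/2) (-1/2)) (Complex (1/2) (1/2)) - ball 0 (1 / (4 * pi))"
  have "compact Z" unfolding Z_def by (intro compact_diff) auto
  have nz: "exp (2 * pi * \<i> * w) \<noteq> 1" "w \<noteq> 0" if "w \<in> Z" for w
  proof -
    show "w \<noteq> 0" using that by (auto simp: Z_def)
    show "exp (2 * pi * \<i> * w) \<noteq> 1"
    proof
      assume "exp (2 * pi * \<i> * w) = 1"
      then obtain n :: int where "Im w = 0" "Re w = of_int n"
        by (auto simp: exp_eq_1)
      moreover from this have "n = 0" using that
        by (auto simp: Z_def in_cbox_complex_iff)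
      ultimately show False using \<open>w \<noteq> 0\<close> by (simp add: complex_eq_iff)
    qed
  qed
  have "continuous_on Z (\<lambda>w. lattice_row w - \<i> / (2 * pi) / w)"
    unfolding lattice_row_def using nz by (intro continuous_intros) auto
  then have "bounded ((\<lambda>w. lattice_row w - \<i> / (2 * pi) / w) ` Z)"
    using \<open>compact Z\<close> by (intro compact_imp_bounded compact_continuous_image)
  then obtain B where B: "\<And>w. w \<in> Z \<Longrightarrow> norm (lattice_row w - \<i> / (2 * pi) / w) \<le> B"
    by (auto simp: bounded_iff)
  have near: "norm (lattice_row w - \<i> / (2 * pi) / w) \<le> 4" if w: "w \<noteq> 0" "norm w < 1 / (4 * pi)" for w
  proof -
    define u where "u = 2 * pi * \<i> * w"
    have u: "u \<noteq> 0" "norm u \<le> 1 / 2"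
      using w by (auto simp: u_def norm_mult field_simps)
    have lb: "1 / 2 * norm u \<le> norm (1 - exp u)"
      using norm_exp_bounds(1)[OF u(2)] by (simp add: norm_minus_commute)
    then have ne: "1 - exp u \<noteq> 0" using u by auto
    have rem: "norm (exp u - 1 - u) \<le> (norm u)\<^sup>2 * 2"
    proof -
      have "norm (exp u - (\<Sum>k\<le>1. u ^ k / fact k)) \<le> exp \<bar>Re u\<bar> * norm u ^ Suc 1 / fact 1"
        by (rule Taylor_exp)
      moreover have "exp \<bar>Re u\<bar> \<le> 2"
        using abs_Re_le_cmod[of u] u(2) exp_half_le2 by (smt (verit) exp_le_cancel_iff)
      ultimately show ?thesis
        using mult_right_mono[of "exp \<bar>Re u\<bar>" 2 "(norm u)\<^sup>2"]
        by (simp add: power2_eq_square diff_diff_eq)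
    qed
    \<comment> \<open>The principal part is -1/u. The numerator is at most 2|u|^2 and the
      denominator at least |u|^2/2, whence the bound 4.\<close>
    have "lattice_row w - \<i> / (2 * pi) / w = (- (exp u - 1 - u)) / (u * (1 - exp u))"
      unfolding lattice_row_def u_def[symmetric] using ne u w
      by (simp add: u_def divide_simps) (simp add: algebra_simps)
    then have "norm (lattice_row w - \<i> / (2 * pi) / w)
        = norm (exp u - 1 - u) / (norm u * norm (1 - exp u))"
      by (simp only: norm_divide norm_mult norm_minus_cancel)
    also have "\<dots> \<le> ((norm u)\<^sup>2 * 2) / (norm u * (1 / 2 * norm u))"
      using rem lb u by (intro frac_le mult_left_mono mult_pos_pos) auto
    also have "\<dots> = 4" using u by (simp add: power2_eq_square)
    finally show ?thesis .
  qed
  show ?thesis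
  proof (intro exI[of _ "max 4 B"] conjI allI impI)
    fix w :: complex assume w: "\<bar>Re w\<bar> \<le> 1/2" "\<bar>Im w\<bar> \<le> 1/2" "w \<noteq> 0"
    show "norm (lattice_row w - \<i> / (2 * pi) / w) \<le> max 4 B"
    proof (cases "norm w < 1 / (4 * pi)")
      case True
      then show ?thesis using near w(3) by fastforce
    next
      case False
      then have "w \<in> Z" using w by (auto simp: Z_def in_cbox_complex_iff abs_le_iff)
      then show ?thesis using B by fastforce
    qed
  qed auto
qed

text \<open>After a shift by a large \<open>M\<close> the argument lies in the right half plane,
  where Gamma is holomorphic. The functional equation then undoes the shift at the cost of finitely
  many simple poles off \<open>K\<close>.\<close>

lemma Gamma_in_poly_closure:
  assumes K: "compact K" "connected (- K)" and a: "a \<noteq> 0"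
    and nonint: "\<And>z. z \<in> K \<Longrightarrow> a * z + b \<notin> \<int>"
  shows "(\<lambda>z. Gamma (a * z + b)) \<in> poly_closure K"
proof -
  obtain B where B: "B > 0" "\<And>z. z \<in> K \<Longrightarrow> norm z \<le> B"
    using compact_imp_bounded[OF K(1)] by (auto simp: bounded_pos)
  obtain M :: nat where M: "norm a * (B + 1) + norm b < real M"
    using reals_Archimedean2 by blast
  have "(\<lambda>z. Gamma (a * z + b + of_nat M)) holomorphic_on ball 0 (B + 1)"
  proof (intro holomorphic_intros)
    fix z assume "z \<in> ball (0::complex) (B + 1)"
    then have "norm (a * z + b) < real M"
      using norm_triangle_ineq[of "a * z" b] mult_left_mono[of "norm z" "B + 1" "norm a"] M
      by (auto simp: norm_mult)
    then have pos: "Re (a * z + b + of_nat M) > 0"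
      using abs_Re_le_cmod[of "a * z + b"] by auto
    show "a * z + b + of_nat M \<notin> \<int>\<^sub>\<le>\<^sub>0"
    proof
      assume "a * z + b + of_nat M \<in> \<int>\<^sub>\<le>\<^sub>0"
      then obtain k where k: "a * z + b + of_nat M = of_int k" "k \<le> 0"
        by (rule nonpos_Ints_cases)
      have "Re (of_int k) > 0" using pos by (simp only: k(1))
      then show False using k(2) by simp
    qed
  qed
  then have 1: "(\<lambda>z. Gamma (a * z + b + of_nat M)) \<in> poly_closure K"
    using B by (intro holomorphic_in_poly_closure[OF K(1), of 0 B]) auto
  have 2: "(\<lambda>z. 1 / a * (1 / (z - (- (b + of_nat i) / a)))) \<in> poly_closure K" for i
  proof (intro poly_closure_cmult inverse_in_poly_closure K notI)
    assume "- (b + of_nat i) / a \<in> K"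
    from nonint[OF this] have "- of_nat i \<notin> (\<int> :: complex set)"
      using a by simp
    then show False by simp
  qed
  have "(\<lambda>z. Gamma (a * z + b + of_nat M) * (\<Prod>i<M. 1 / a * (1 / (z - (- (b + of_nat i) / a)))))
      \<in> poly_closure K"
    by (intro poly_closure_mult poly_closure_prod K 1 2)
  then show ?thesis
  proof (rule poly_closure_cong)
    fix z assume z: "z \<in> K"
    let ?w = "a * z + b"
    have w: "?w + of_nat i \<noteq> 0" for i
      using nonint[OF z] by (metis Ints_minus Ints_of_nat add_eq_0_iff2)
    have "1 / a * (1 / (z - (- (b + of_nat i) / a))) = 1 / (?w + of_nat i)" for i
      using a w[of i] by (simp add: field_simps)
    then have "(\<Prod>i<M. 1 / a * (1 / (z - (- (b + of_nat i) / a)))) = 1 / pochhammer ?w M"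
      by (simp add: pochhammer_prod prod_dividef atLeast0LessThan)
    moreover have "pochhammer ?w M = Gamma (?w + of_nat M) / Gamma ?w"
      using nonint[OF z] nonpos_Ints_Int by (intro pochhammer_Gamma) blast
    moreover have "Gamma (?w + of_nat M) \<noteq> 0"
      using nonint[OF z] nonpos_Ints_Int[of "?w + of_nat M"] by (auto simp: Gamma_eq_zero_iff)
    ultimately show "Gamma (a * z + b + of_nat M) * (\<Prod>i<M. 1 / a * (1 / (z - (- (b + of_nat i) / a)))) = Gamma ?w"
      by simp
  qed
qed

text \<open>By the reflection formula, the zeros of \<open>1 - exp (2 \<pi> \<i> w)\<close> can be divided out one by one
  through the poles of the Gamma function.\<close>
lemma lattice_row_in_poly_closure:
  assumes K: "compact K" "connected (- K)" and a: "a \<noteq> 0"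
    and nonint: "\<And>z. z \<in> K \<Longrightarrow> a * z + b \<notin> \<int>"
  shows "(\<lambda>z. lattice_row (a * z + b)) \<in> poly_closure K"
proof -
  have 1: "(\<lambda>z. Gamma (a * z + b)) \<in> poly_closure K"
    by (intro Gamma_in_poly_closure assms)
  have 2: "(\<lambda>z. Gamma (- a * z + (1 - b))) \<in> poly_closure K"
  proof (intro Gamma_in_poly_closure K)
    show "- a * z + (1 - b) \<notin> \<int>" if "z \<in> K" for z
    proof
      assume "- a * z + (1 - b) \<in> \<int>"
      then have "1 - (- a * z + (1 - b)) \<in> \<int>" by (intro Ints_diff) auto
      then show False using nonint[OF that] by (simp add: algebra_simps)
    qed
  qed (use a in auto)
  have 3: "(\<lambda>z. exp (- (pi * \<i> * (a * z + b)))) \<in> poly_closure K"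
  proof -
    obtain B where "\<And>z. z \<in> K \<Longrightarrow> norm z \<le> B"
      using compact_imp_bounded[OF K(1)] by (auto simp: bounded_pos)
    then show ?thesis
      by (intro holomorphic_in_poly_closure[OF K(1), of 0 B "B + 1"] holomorphic_intros) auto
  qed
  \<comment> \<open>With w = a z + b, the row is (\<i>/2) exp(-pi \<i> w) / sin(pi w), and pi /
    sin(pi w) = Gamma(w) Gamma(1 - w).\<close>
  have "(\<lambda>z. \<i> / (2 * pi) * (exp (- (pi * \<i> * (a * z + b))) *
      (Gamma (a * z + b) * Gamma (- a * z + (1 - b))))) \<in> poly_closure K"
    by (intro poly_closure_cmult poly_closure_mult K 1 2 3)
  then show ?thesis
  proof (rule poly_closure_cong)
    fix z assume z: "z \<in> K"
    define w where "w = a * z + b"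
    define E where "E = exp (pi * \<i> * w)"
    have "E \<noteq> 0" by (simp add: E_def)
    have s: "sin (pi * w) = - \<i> / 2 * (E - 1 / E)"
      by (simp add: sin_exp_eq' E_def mult_ac exp_minus field_simps)
    have "exp (2 * pi * \<i> * w) = E * E"
      by (simp add: E_def mult_ac flip: exp_add)
    moreover have "exp (2 * pi * \<i> * w) \<noteq> 1"
    proof
      assume "exp (2 * pi * \<i> * w) = 1"
      then obtain n :: int where "Im w = 0" "Re w = of_int n"
        by (auto simp: exp_eq_1)
      then have "w = of_int n" by (simp add: complex_eq_iff)
      then show False using nonint[OF z] by (simp add: w_def)
    qed
    ultimately have "E * E \<noteq> 1" "lattice_row w = 1 / (1 - E * E)" by (simp_all add: lattice_row_def)
    note this(2)
    also have "\<dots> = \<i> / (2 * pi) * (1 / E * (pi / sin (pi * w)))"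
      using \<open>E * E \<noteq> 1\<close> \<open>E \<noteq> 0\<close> unfolding s by (simp add: field_simps)
    also have "pi / sin (pi * w) = Gamma w * Gamma (1 - w)"
      by (simp add: Gamma_reflection_complex)
    also have "1 - w = - a * z + (1 - b)" by (simp add: w_def)
    also have "1 / E = exp (- (pi * \<i> * w))" by (simp add: E_def exp_minus field_simps)
    finally show "\<i> / (2 * pi) * (exp (- (pi * \<i> * (a * z + b))) *
      (Gamma (a * z + b) * Gamma (- a * z + (1 - b)))) = lattice_row (a * z + b)"
      by (simp add: w_def)
  qed
qed

section \<open>Harmonic sums that control the lattice errors\<close>

definition decay :: "int \<Rightarrow> real"
  where "decay a = 1 / max 1 \<bar>a\<bar>"

lemma decay_pos: "decay a > 0"
  by (simp add: decay_def)

text \<open>The range reaches 2N because indices in [-N, N] are recentred at a point of the same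
  interval.\<close>

definition decay_sum :: "nat \<Rightarrow> real"
  where "decay_sum N = (\<Sum>a\<in>{- 2 * int N..2 * int N}. decay a)"

lemma sum_decay_shift_le:
  assumes "\<bar>k\<bar> \<le> int N"
  shows "(\<Sum>n\<in>{- int N..int N}. decay (n - k)) \<le> decay_sum N"
proof -
  have "(\<Sum>n\<in>{- int N..int N}. decay (n - k)) = (\<Sum>a\<in>(\<lambda>n. n - k) ` {- int N..int N}. decay a)"
    by (subst sum.reindex) (auto simp: inj_on_def)
  also have "\<dots> \<le> decay_sum N"
    unfolding decay_sum_def using assms decay_pos less_imp_le by (intro sum_mono2) auto
  finally show ?thesis .
qed

lemma one_le_decay_sum: "1 \<le> decay_sum N"
  using member_le_sum[of 0 "{- 2 * int N..2 * int N}" decay] decay_pos less_imp_le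
  by (force simp: decay_sum_def decay_def)

lemma decay_sum_eq: "decay_sum N = 1 + 2 * harm (2 * N)"
proof -
  have split: "{- 2 * int N..2 * int N} = {0} \<union> (int ` {1..2 * N} \<union> (\<lambda>n. - int n) ` {1..2 * N})"
  proof (intro equalityI subsetI)
    fix x assume "x \<in> {- 2 * int N..2 * int N}"
    then have "x = 0 \<or> x = int (nat x) \<and> nat x \<in> {1..2 * N} \<or> x = - int (nat (- x)) \<and> nat (- x) \<in> {1..2 * N}"
      by auto
    then show "x \<in> {0} \<union> (int ` {1..2 * N} \<union> (\<lambda>n. - int n) ` {1..2 * N})" by blast
  qed auto
  have "decay_sum N = decay 0 + (sum decay (int ` {1..2 * N}) + sum decay ((\<lambda>n. - int n) ` {1..2 * N}))"
    unfolding decay_sum_def split by (subst sum.union_disjoint; (subst sum.union_disjoint)?; force)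
  also have "sum decay (int ` {1..2 * N}) = harm (2 * N)"
    by (subst sum.reindex) (auto simp: inj_on_def harm_def decay_def divide_simps intro!: sum.cong)
  also have "sum decay ((\<lambda>n. - int n) ` {1..2 * N}) = harm (2 * N)"
    by (subst sum.reindex) (auto simp: inj_on_def harm_def decay_def divide_simps intro!: sum.cong)
  finally show ?thesis by (simp add: decay_def)
qed

lemma decay_sum_square_negligible: "(\<lambda>N. (decay_sum N)\<^sup>2 / N) \<longlonglongrightarrow> 0"
proof (rule tendsto_sandwich[where f = "\<lambda>_. 0"])
  have le: "(decay_sum N)\<^sup>2 / N \<le> (1 + 2 * (1 + ln (real (2 * N))))\<^sup>2 / N" if "N > 0" for N
  proof (intro divide_right_mono power_mono)
    \<comment> \<open>\<open>harm n - ln n\<close> decreases and equals 1 at n = 1.\<close>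
    have "harm (2 * N) \<le> 1 + ln (real (2 * N))"
      using euler_mascheroni_sequence_decreasing[of 1 "2 * N"] that by (simp add: harm_expand)
    then show "decay_sum N \<le> 1 + 2 * (1 + ln (real (2 * N)))"
      by (simp add: decay_sum_eq)
    show "0 \<le> decay_sum N" using one_le_decay_sum[of N] by linarith
  qed auto
  show "\<forall>\<^sub>F N in sequentially. (decay_sum N)\<^sup>2 / N \<le> (1 + 2 * (1 + ln (real (2 * N))))\<^sup>2 / N"
    using eventually_gt_at_top[of "0::nat"] by (rule eventually_mono) (rule le)
  show "(\<lambda>N. (1 + 2 * (1 + ln (real (2 * N))))\<^sup>2 / N) \<longlonglongrightarrow> 0"
    by real_asymp
qed auto

text \<open>Each row below \<open>w\<close> contributes about \<open>1\<close> and each row above about \<open>0\<close>, so the sum counts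
  \<open>Im w\<close>.\<close>
lemma lattice_row_sum:
  "\<exists>C>0. \<forall>N w. \<bar>round (Re w)\<bar> \<le> int N \<longrightarrow> \<bar>round (Im w)\<bar> \<le> int N \<longrightarrow>
     w \<noteq> Complex (round (Re w)) (round (Im w)) \<longrightarrow>
     norm ((\<Sum>n\<in>{- int N..int N}. lattice_row (w - \<i> * of_int n)) - (Im w + N)
        - \<i> / (2 * pi) / (w - Complex (round (Re w)) (round (Im w)))) \<le> C + 2 * decay_sum N"
proof -
  obtain C where C: "C > 0" "\<And>w. \<bar>Re w\<bar> \<le> 1/2 \<Longrightarrow> \<bar>Im w\<bar> \<le> 1/2 \<Longrightarrow> w \<noteq> 0 \<Longrightarrow>
    norm (lattice_row w - \<i> / (2 * pi) / w) \<le> C" using lattice_row_near_pole by blast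
  show ?thesis
  \<comment> \<open>\<open>C\<close> bounds the row nearest to \<open>w\<close> without its pole;
    the extra 1 absorbs the rounding error of \<open>Im w\<close>.\<close>
  proof (intro exI[of _ "C + 1"] conjI allI impI)
    fix N w
    define m n where "m = round (Re w)" and "n = round (Im w)"
    assume "\<bar>round (Re w)\<bar> \<le> int N" and n: "\<bar>round (Im w)\<bar> \<le> int N"
      and ne: "w \<noteq> Complex (round (Re w)) (round (Im w))"
    define p where "p = \<i> / (2 * pi) / (w - Complex m n)"
    \<comment> \<open>The limiting value of each row; the rows -N, ..., n - 1 give the count n + N,
      and row n itself is assigned 0.\<close>
    define s :: "int \<Rightarrow> complex" where "s k = (if k < n then 1 else 0)" for k
    define D where "D k = lattice_row (w - \<i> * of_int k) - s k - (if k = n then p else 0)" for k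
    let ?I = "{- int N..int N}"
    have rnd: "\<bar>Re w - m\<bar> \<le> 1/2" "\<bar>Im w - n\<bar> \<le> 1/2"
      using of_int_round_abs_le[of "Re w"] of_int_round_abs_le[of "Im w"]
      by (auto simp: m_def n_def abs_minus_commute)
    have "sum s ?I = (\<Sum>k\<in>{- int N..<n}. 1)"
      using n by (intro sum.mono_neutral_cong_right) (auto simp: s_def n_def)
    also have "\<dots> = of_int (n + int N)"
      using n by (simp add: n_def)
    finally have ss: "sum s ?I = of_int (n + int N)" .
    have "D k = lattice_row (w - \<i> * of_int k) - s k - (if k = n then p else 0)" for k by (simp add: D_def)
    then have "sum D ?I = (\<Sum>k\<in>?I. lattice_row (w - \<i> * of_int k)) - of_int (n + int N) - p"
      using n by (auto simp: sum_subtractf ss n_def sum.delta)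
    then have eq: "(\<Sum>k\<in>?I. lattice_row (w - \<i> * of_int k)) - (Im w + N) - p = sum D ?I - of_real (Im w - n)"
      by (simp add: algebra_simps)
    have D: "norm (D k) \<le> (if k = n then C else 0) + 2 * decay (k - n)" for k
    proof (cases k n rule: linorder_cases)
      case equal
      have "lattice_row (w - \<i> * of_int n) = lattice_row (w - \<i> * of_int n - of_int m)"
        by (simp add: lattice_row_minus_of_int)
      also have "w - \<i> * of_int n - of_int m = w - Complex m n"
        by (simp add: complex_eq_iff)
      finally have "norm (D k) \<le> C"
        using C(2)[of "w - Complex m n"] rnd ne equal by (simp add: D_def s_def p_def m_def n_def)
      then show ?thesis using equal decay_pos[of 0] by simp
    next
      case less
      then have "real_of_int n - real_of_int k \<ge> 1" by linarith
      \<comment> \<open>Rounding costs at most 1/2, which is at most half of n - k >= 1.\<close>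
      then have pos: "Im (w - \<i> * of_int k) \<ge> real_of_int (n - k) / 2"
        using rnd(2) unfolding abs_le_iff by simp
      have "norm (D k) \<le> 1 / Im (w - \<i> * of_int k)"
        using lattice_row_upper[of "w - \<i> * of_int k"] less pos by (simp add: D_def s_def)
      also have "\<dots> \<le> 1 / (real_of_int (n - k) / 2)"
        using less pos by (intro divide_left_mono mult_pos_pos) auto
      also have "\<dots> = 2 * decay (k - n)" using less by (simp add: decay_def max_def abs_if)
      finally show ?thesis using less by simp
    next
      case greater
      then have "real_of_int k - real_of_int n \<ge> 1" by linarith
      then have neg: "- Im (w - \<i> * of_int k) \<ge> real_of_int (k - n) / 2"
        using rnd(2) unfolding abs_le_iff by simp
      have "norm (D k) \<le> 1 / (- Im (w - \<i> * of_int k))"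
        using lattice_row_lower[of "w - \<i> * of_int k"] greater neg by (simp add: D_def s_def)
      also have "\<dots> \<le> 1 / (real_of_int (k - n) / 2)"
        using greater neg by (intro divide_left_mono mult_pos_pos) auto
      also have "\<dots> = 2 * decay (k - n)" using greater by (simp add: decay_def max_def abs_if)
      finally show ?thesis using greater by simp
    qed
    have "norm (sum D ?I) \<le> (\<Sum>k\<in>?I. (if k = n then C else 0) + 2 * decay (k - n))"
      using D by (rule sum_norm_le)
    also have "\<dots> = C + 2 * (\<Sum>k\<in>?I. decay (k - n))"
      using n by (simp add: sum.distrib sum_distrib_left sum.delta n_def abs_le_iff)
    also have "\<dots> \<le> C + 2 * decay_sum N"
      using sum_decay_shift_le[OF n] by (simp add: n_def)
    finally have "norm (sum D ?I - of_real (Im w - n)) \<le> C + 2 * decay_sum N + 1"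
      using norm_triangle_ineq4[of "sum D ?I" "of_real (Im w - n)"] rnd(2) by (simp del: of_real_diff)
    then have "norm ((\<Sum>n\<in>?I. lattice_row (w - \<i> * of_int n)) - (Im w + N) - p) \<le> C + 1 + 2 * decay_sum N"
      unfolding eq by simp
    then show "norm ((\<Sum>n\<in>?I. lattice_row (w - \<i> * of_int n)) - (Im w + N)
        - \<i> / (2 * pi) / (w - Complex (round (Re w)) (round (Im w)))) \<le> C + 1 + 2 * decay_sum N"
      by (simp only: p_def m_def n_def)
  qed (use C in auto)
qed

section \<open>Lavrentiev's theorem\<close>

text \<open>For each \<open>j\<close> the forbidden shifts form an affine copy of \<open>K\<close>,
  closed with empty interior. Finitely many of them cannot cover the unit disc.\<close>

lemma lattice_avoidance:
  fixes K :: "complex set"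
  assumes "closed K" "interior K = {}" "finite J" "\<delta> > 0"
  obtains t where "norm t < 1" "\<And>j. j \<in> J \<Longrightarrow> of_real \<delta> * (t + j) \<notin> K"
proof -
  define T where "T j = (\<lambda>t. of_real \<delta> * (t + j)) -` K" for j
  have cl: "closed (T j)" for j
    unfolding T_def using assms(1) by (intro closed_vimage continuous_intros)
  have int: "interior (T j) = {}" for j
  proof -
    let ?f = "\<lambda>z. z / of_real \<delta> - j"
    have "?f -` interior (T j) \<subseteq> K"
      using interior_subset[of "T j"] assms(4) by (auto simp: T_def)
    moreover have "open (?f -` interior (T j))"
      using assms(4) by (intro open_vimage continuous_intros) auto
    ultimately have "?f -` interior (T j) = {}"
      using assms(2) by (metis interior_maximal subset_empty)
    moreover have "?f (of_real \<delta> * (t + j)) = t" for t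
      using assms(4) by simp
    ultimately show ?thesis by (metis empty_iff equals0I vimageI2)
  qed
  have "interior (\<Union>j\<in>J. T j) = {}"
    using assms(3)
    by (induction J rule: finite_induct) (simp_all add: interior_closed_Un_empty_interior cl int)
  then have "\<not> ball 0 1 \<subseteq> (\<Union>j\<in>J. T j)"
    using interior_maximal[OF _ open_ball] by (metis ball_eq_empty not_one_le_zero subset_empty)
  then show ?thesis using that by (force simp: T_def)
qed

text \<open>The distance is at least half the larger coordinate offset M from the nearest lattice
  point, and 1/M^2 is at most the product of the two decays. The product form lets the double sum
  factor.\<close>

lemma lattice_distance:
  fixes w :: complex
  assumes "(m, n) \<noteq> (round (Re w), round (Im w))"
  shows "1 / (norm (w - Complex m n))\<^sup>2 \<le> 4 * (decay (m - round (Re w)) * decay (n - round (Im w)))"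
    and "1 / 2 \<le> norm (w - Complex m n)"
proof -
  define p q where "p = m - round (Re w)" and "q = n - round (Im w)"
  define M where "M = max \<bar>p\<bar> \<bar>q\<bar>"
  have M: "M \<ge> 1" using assms by (auto simp: M_def p_def q_def)
  have half: "real_of_int \<bar>k - round x\<bar> / 2 \<le> \<bar>x - k\<bar>" for x :: real and k :: int
  proof (cases "k = round x")
    case False
    then have "1 \<le> real_of_int \<bar>k - round x\<bar>" by linarith
    moreover have "real_of_int \<bar>k - round x\<bar> = \<bar>(real_of_int k - x) + (x - real_of_int (round x))\<bar>" by simp
    ultimately show ?thesis
      using of_int_round_abs_le[of x] abs_triangle_ineq[of "real_of_int k - x" "x - real_of_int (round x)"]
        abs_minus_commute[of x "real_of_int k"] abs_minus_commute[of x "real_of_int (round x)"]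
      by linarith
  qed simp
  have "real_of_int \<bar>p\<bar> / 2 \<le> norm (w - Complex m n)" "real_of_int \<bar>q\<bar> / 2 \<le> norm (w - Complex m n)"
    using half[of m "Re w"] half[of n "Im w"] abs_Re_le_cmod[of "w - Complex m n"]
      abs_Im_le_cmod[of "w - Complex m n"] by (auto simp: p_def q_def)
  then have d: "real_of_int M / 2 \<le> norm (w - Complex m n)" by (auto simp: M_def max_def)
  then show "1 / 2 \<le> norm (w - Complex m n)" using M by linarith
  have "1 / (norm (w - Complex m n))\<^sup>2 \<le> 1 / (real_of_int M / 2)\<^sup>2"
    using d M by (intro divide_left_mono power_mono mult_pos_pos) auto
  also have "\<dots> = 4 * (1 / M * (1 / M))"
    by (simp add: power2_eq_square)
  also have "\<dots> \<le> 4 * (decay p * decay q)"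
    unfolding decay_def using M
    by (intro mult_left_mono mult_mono divide_left_mono mult_pos_pos) (auto simp: M_def)
  finally show "1 / (norm (w - Complex m n))\<^sup>2 \<le> 4 * (decay (m - round (Re w)) * decay (n - round (Im w)))"
    by (simp add: p_def q_def)
qed

text \<open>Lengths are in units of \<open>\<delta>\<close>, so the hypotheses are the two bounds of
  \<open>bounded_pole_approximation\<close>. The pole nearest to \<open>w\<close> is left out, as it
  is unbounded; the lattice sum cancels it.\<close>

lemma pole_replacement_error:
  fixes w g :: complex
  assumes near: "norm (w - Complex m n) \<le> 9 \<Longrightarrow> norm g \<le> 160"
    and far: "9 \<le> norm (w - Complex m n) \<Longrightarrow>
      norm (g - 1 / (w - Complex m n)) \<le> 160 / (norm (w - Complex m n))\<^sup>2"
  defines "j0 \<equiv> (round (Re w), round (Im w))"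
  shows "norm ((if (m, n) = j0 then 0 else 1 / (w - Complex m n)) - g)
    \<le> 60000 * (decay (m - round (Re w)) * decay (n - round (Im w)))"
proof (cases "(m, n) = j0")
  case True
  have "norm (w - Complex m n) \<le> \<bar>Re w - m\<bar> + \<bar>Im w - n\<bar>"
    using cmod_le[of "w - Complex m n"] by simp
  also have "\<dots> \<le> 9"
    using True of_int_round_abs_le[of "Re w"] of_int_round_abs_le[of "Im w"]
    by (auto simp: j0_def abs_minus_commute)
  finally show ?thesis using near True by (simp add: j0_def decay_def)
next
  case False
  define x where "x = norm (w - Complex m n)"
  define D where "D = decay (m - round (Re w)) * decay (n - round (Im w))"
  have D: "1 / x\<^sup>2 \<le> 4 * D" and x: "1 / 2 \<le> x"
    using lattice_distance[of m n w] False by (auto simp: j0_def x_def D_def)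
  have "norm (1 / (w - Complex m n) - g) \<le> 60000 * D"
  proof (cases "9 \<le> x")
    case True
    then have "norm (1 / (w - Complex m n) - g) \<le> 160 * (1 / x\<^sup>2)"
      using far by (simp add: x_def norm_minus_commute)
    also have "\<dots> \<le> 160 * (4 * D)" using D by (intro mult_left_mono) auto
    also have "\<dots> \<le> 60000 * D" by (simp add: D_def decay_pos less_imp_le)
    finally show ?thesis .
  next
    case False
    have "norm (1 / (w - Complex m n) - g) \<le> 1 / x + 160"
      using norm_triangle_ineq4[of "1 / (w - Complex m n)" g] near False by (simp add: x_def norm_divide)
    also have "1 / x \<le> 2" using x by (simp add: divide_simps)
    \<comment> \<open>For x < 9 the constant 162 is below 15000/81, hence below 15000/x^2 <= 60000
      D.\<close>
    also have "2 + 160 \<le> 15000 * (1 / 81 :: real)" by simp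
    also have "(1 / 81 :: real) \<le> 1 / x\<^sup>2"
      using False x power_mono[of x 9 2] by (intro divide_left_mono) auto
    also note D
    finally show ?thesis by simp
  qed
  then show ?thesis using False by (simp add: D_def)
qed

lemma Im_in_poly_closure:
  assumes K: "compact K" "connected (- K)" and int: "interior K = {}"
  shows "(\<lambda>z. of_real (Im z)) \<in> poly_closure K"
proof (rule poly_closure_limit)
  fix e :: real assume e: "e > 0"
  obtain B where B: "B > 0" "\<And>z. z \<in> K \<Longrightarrow> norm z \<le> B"
    using compact_imp_bounded[OF K(1)] by (auto simp: bounded_pos)
  obtain C where C: "C > 0" "\<And>N w. \<bar>round (Re w)\<bar> \<le> int N \<Longrightarrow> \<bar>round (Im w)\<bar> \<le> int N \<Longrightarrow>
     w \<noteq> Complex (round (Re w)) (round (Im w)) \<Longrightarrow>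
     norm ((\<Sum>n\<in>{- int N..int N}. lattice_row (w - \<i> * of_int n)) - (Im w + N)
        - \<i> / (2 * pi) / (w - Complex (round (Re w)) (round (Im w)))) \<le> C + 2 * decay_sum N"
    using lattice_row_sum by blast
  define C' where "C' = C + 2 + 60000"
  have "(\<lambda>N. 2 * B * C' * ((decay_sum N)\<^sup>2 / N)) \<longlonglongrightarrow> 2 * B * C' * 0"
    by (intro tendsto_mult_left decay_sum_square_negligible)
  then have "\<forall>\<^sub>F N in sequentially. 2 * B * C' * ((decay_sum N)\<^sup>2 / N) < e"
    using e by (intro order_tendstoD(2)) auto
  then obtain N where N: "N \<ge> 2" "2 * B * C' * ((decay_sum N)\<^sup>2 / N) < e"
    using eventually_conj[OF _ eventually_ge_at_top[of 2]] eventually_happens'[OF sequentially_bot]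
    by (metis (mono_tags, lifting))
  \<comment> \<open>The set \<open>K\<close> scaled by 1/\<delta> lies in the disc of radius N/2. As
    |t| < 1 <= N/2, \<open>w z\<close> stays within radius N and its nearest lattice point has both
    indices in \<open>I\<close>.\<close>
  define \<delta> where "\<delta> = 2 * B / N"
  have \<delta>: "\<delta> > 0" using B N by (simp add: \<delta>_def)
  define I where "I = {- int N..int N}"
  have "finite ((\<lambda>(m, n). Complex (of_int m) (of_int n)) ` (I \<times> I))"
    by (auto simp: I_def)
  then obtain t where t: "norm t < 1"
    and "\<And>j. j \<in> (\<lambda>(m, n). Complex (of_int m) (of_int n)) ` (I \<times> I) \<Longrightarrow> of_real \<delta> * (t + j) \<notin> K"
    using lattice_avoidance[OF compact_imp_closed[OF K(1)] int _ \<delta>] by metis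
  then have avoid: "of_real \<delta> * (t + Complex m n) \<notin> K" if "m \<in> I" "n \<in> I" for m n :: int
    using that by force
  define c where "c m n = of_real \<delta> * (t + Complex (of_int m) (of_int n))" for m n :: int
  define w where "w z = 1 / of_real \<delta> * z - t" for z
  have zc: "z - c m n = of_real \<delta> * (w z - Complex m n)" for z m n
    using \<delta> by (simp add: c_def w_def algebra_simps)
  have nw: "norm (w z) \<le> N" if "z \<in> K" for z
  proof -
    have "norm (w z) \<le> norm (1 / of_real \<delta> * z) + norm t"
      unfolding w_def by (rule norm_triangle_ineq4)
    also have "norm (1 / of_real \<delta> * z) \<le> N / 2"
      using B(2)[OF that] B(1) N(1) by (simp add: norm_mult norm_divide \<delta>_def divide_simps)
    finally show ?thesis using t N(1) by linarith
  qed
  have box: "\<bar>Re (w z)\<bar> \<le> N" "\<bar>Im (w z)\<bar> \<le> N" if "z \<in> K" for z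
    using nw[OF that] abs_Re_le_cmod[of "w z"] abs_Im_le_cmod[of "w z"] by linarith+
  have rnd_le: "\<bar>round x\<bar> \<le> int N" if "\<bar>x\<bar> \<le> real N" for x :: real
  proof -
    have "round (of_int (- int N) :: real) \<le> round x" "round x \<le> round (of_int (int N) :: real)"
      using that unfolding abs_le_iff by (simp_all only: round_mono of_int_of_nat_eq of_int_minus minus_le_iff)
    then show ?thesis unfolding round_of_int by linarith
  qed
  \<comment> \<open>Lattice points with indices in \<open>I\<close> are avoided by the choice of
    \<open>t\<close>; the others are out of reach by \<open>box\<close>.\<close>
  have ne: "w z \<noteq> Complex m n" if "z \<in> K" for z and m n :: int
  proof
    assume eq: "w z = Complex m n"
    then have "m \<in> I" "n \<in> I" using box[OF that] by (auto simp: I_def)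
    moreover have "z = c m n" using zc[of z m n] eq by simp
    ultimately show False using avoid that by (simp add: c_def)
  qed
  define Q where "Q m n h \<longleftrightarrow> h \<in> poly_closure K \<and>
      (\<forall>z\<in>K. norm (z - c m n) \<le> 9 * \<delta> \<longrightarrow> norm (h z) \<le> 160 / \<delta>) \<and>
      (\<forall>z\<in>K. 9 * \<delta> \<le> norm (z - c m n) \<longrightarrow>
        norm (h z - 1 / (z - c m n)) \<le> 160 * \<delta> / (norm (z - c m n))\<^sup>2)" for m n h
  have "\<exists>h. m \<in> I \<longrightarrow> n \<in> I \<longrightarrow> Q m n h" for m n
  proof (cases "m \<in> I \<and> n \<in> I")
    case True
    then have "c m n \<notin> K" using avoid by (simp add: c_def)
    then obtain h where "h \<in> poly_closure K"
      "\<And>z. z \<in> K \<Longrightarrow> norm (z - c m n) \<le> 9 * \<delta> \<Longrightarrow> norm (h z) \<le> 160 / \<delta>"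
      "\<And>z. z \<in> K \<Longrightarrow> 9 * \<delta> \<le> norm (z - c m n) \<Longrightarrow>
        norm (h z - 1 / (z - c m n)) \<le> 160 * \<delta> / (norm (z - c m n))\<^sup>2"
      using bounded_pole_approximation[OF K _ \<delta>] by metis
    then have "Q m n h" by (simp add: Q_def)
    then show ?thesis by blast
  qed auto
  then obtain g where Q: "\<And>m n. m \<in> I \<Longrightarrow> n \<in> I \<Longrightarrow> Q m n (g m n)" by metis
  have g: "g m n \<in> poly_closure K"
    "z \<in> K \<Longrightarrow> norm (z - c m n) \<le> 9 * \<delta> \<Longrightarrow> norm (g m n z) \<le> 160 / \<delta>"
    "z \<in> K \<Longrightarrow> 9 * \<delta> \<le> norm (z - c m n) \<Longrightarrow>
      norm (g m n z - 1 / (z - c m n)) \<le> 160 * \<delta> / (norm (z - c m n))\<^sup>2"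
    if "m \<in> I" "n \<in> I" for m n z
    using Q[OF that] by (simp_all add: Q_def)
  define \<kappa> where "\<kappa> = \<i> / (2 * pi)"
  have \<kappa>: "norm \<kappa> \<le> 1" using pi_ge_two by (simp add: \<kappa>_def norm_divide)
  define F where "F z = (\<Sum>n\<in>I. lattice_row (w z - \<i> * of_int n))" for z
  define R where "R z = (\<Sum>m\<in>I. \<Sum>n\<in>I. 1 / (w z - Complex m n) - \<delta> * g m n z)" for z
  \<comment> \<open>\<open>F\<close> is close to Im w + N + \<kappa> p, where p is the nearest pole
    term, and \<open>R\<close> is close to p. Hence P is close to \<delta> (Im w + Im t) = Im
    z.\<close>
  define P where "P z = \<delta> * (F z - \<kappa> * R z + (Im t - N))" for z
  have F: "F \<in> poly_closure K"
  proof -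
    have "(\<lambda>z. lattice_row (1 / of_real \<delta> * z + (- t - \<i> * of_int n))) \<in> poly_closure K" for n
    proof (rule lattice_row_in_poly_closure[OF K])
      fix z assume z: "z \<in> K"
      show "1 / of_real \<delta> * z + (- t - \<i> * of_int n) \<notin> \<int>"
      proof
        assume "1 / of_real \<delta> * z + (- t - \<i> * of_int n) \<in> \<int>"
        then obtain m where "w z - \<i> * of_int n = of_int m"
          by (auto simp: w_def algebra_simps elim: Ints_cases)
        then have "w z = Complex m n" by (simp add: complex_eq_iff)
        then show False using ne[OF z] by blast
      qed
    qed (use \<delta> in auto)
    then have "(\<lambda>z. \<Sum>n\<in>I. lattice_row (1 / of_real \<delta> * z + (- t - \<i> * of_int n))) \<in> poly_closure K"
      by (intro poly_closure_sum)
    moreover have "1 / of_real \<delta> * z + (- t - \<i> * of_int n) = w z - \<i> * of_int n" for z n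
      by (simp add: w_def)
    ultimately show ?thesis unfolding F_def by (simp only:)
  qed
  have "(\<lambda>z. \<delta> * (1 / (z - c m n))) \<in> poly_closure K" if "m \<in> I" "n \<in> I" for m n
    using avoid[OF that] by (intro poly_closure_cmult inverse_in_poly_closure K) (simp add: c_def)
  then have pole: "(\<lambda>z. 1 / (w z - Complex m n)) \<in> poly_closure K" if "m \<in> I" "n \<in> I" for m n
    using \<delta> that by (simp add: zc)
  have "R \<in> poly_closure K"
    unfolding R_def by (intro poly_closure_sum poly_closure_diff poly_closure_cmult K pole g)
  then have "P \<in> poly_closure K"
    unfolding P_def by (intro poly_closure_cmult poly_closure_add poly_closure_diff F K const_in_poly_closure)
  moreover have "norm (of_real (Im z) - P z) < e" if z: "z \<in> K" for z
  proof -
    define m0 n0 where "m0 = round (Re (w z))" and "n0 = round (Im (w z))"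
    have mn: "m0 \<in> I" "n0 \<in> I"
      using rnd_le[OF box(1)[OF z]] rnd_le[OF box(2)[OF z]] by (auto simp: I_def m0_def n0_def)
    define p where "p = 1 / (w z - Complex m0 n0)"
    \<comment> \<open>Dropping the nearest pole turns \<open>R z - p\<close> into a double sum of
      bounded replacement errors.\<close>
    define T where "T m n = (if (m, n) = (m0, n0) then 0 else 1 / (w z - Complex m n)) - \<delta> * g m n z" for m n
    have "norm (F z - (Im (w z) + N) - \<kappa> * p) \<le> C + 2 * decay_sum N"
      using C(2)[OF rnd_le[OF box(1)[OF z]] rnd_le[OF box(2)[OF z]] ne[OF z]]
      by (simp add: F_def I_def \<kappa>_def p_def m0_def n0_def)
    moreover have "norm (R z - p) \<le> 60000 * (decay_sum N)\<^sup>2"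
    proof -
      have "1 / (w z - Complex m n) - \<delta> * g m n z = T m n + (if m = m0 then if n = n0 then p else 0 else 0)" for m n
        by (simp add: T_def p_def)
      then have "R z = (\<Sum>m\<in>I. \<Sum>n\<in>I. T m n) + (\<Sum>m\<in>I. \<Sum>n\<in>I. if m = m0 then if n = n0 then p else 0 else 0)"
        unfolding R_def by (simp only: sum.distrib)
      also have "(\<Sum>m\<in>I. \<Sum>n\<in>I. if m = m0 then if n = n0 then p else 0 else 0) = (\<Sum>m\<in>I. if m = m0 then p else 0)"
        using mn by (intro sum.cong refl) (simp add: I_def)
      also have "\<dots> = p" using mn by (simp add: I_def)
      finally have "norm (R z - p) = norm (\<Sum>m\<in>I. \<Sum>n\<in>I. T m n)" by simp
      also have "\<dots> \<le> (\<Sum>m\<in>I. \<Sum>n\<in>I. 60000 * (decay (m - m0) * decay (n - n0)))"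
      proof (intro sum_norm_le)
        fix m n assume I: "m \<in> I" "n \<in> I"
        have nzc: "norm (z - c m n) = \<delta> * norm (w z - Complex m n)"
          using \<delta> by (simp add: zc norm_mult)
        show "norm (T m n) \<le> 60000 * (decay (m - m0) * decay (n - n0))"
          unfolding T_def m0_def n0_def
        proof (rule pole_replacement_error)
          show "norm (\<delta> * g m n z) \<le> 160" if "norm (w z - Complex m n) \<le> 9"
            using g(2)[OF I z] \<delta> that by (simp add: nzc norm_mult field_simps)
          show "norm (\<delta> * g m n z - 1 / (w z - Complex m n)) \<le> 160 / (norm (w z - Complex m n))\<^sup>2"
            if "9 \<le> norm (w z - Complex m n)"
          proof -
            have scaled: "\<delta> * (1 / (z - c m n)) = 1 / (w z - Complex m n)"
              using \<delta> by (simp add: zc)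
            have "\<delta> * g m n z - 1 / (w z - Complex m n) = \<delta> * (g m n z - 1 / (z - c m n))"
              using scaled by (simp only: right_diff_distrib)
            then have "norm (\<delta> * g m n z - 1 / (w z - Complex m n)) = \<delta> * norm (g m n z - 1 / (z - c m n))"
              using \<delta> by (simp add: norm_mult)
            also have "\<dots> \<le> \<delta> * (160 * \<delta> / (norm (z - c m n))\<^sup>2)"
              using g(3)[OF I z] \<delta> that by (intro mult_left_mono) (auto simp: nzc)
            also have "\<dots> = 160 / (norm (w z - Complex m n))\<^sup>2"
              using \<delta> by (simp add: nzc power2_eq_square)
            finally show ?thesis .
          qed
        qed
      qed
      also have "\<dots> = 60000 * ((\<Sum>m\<in>I. decay (m - m0)) * (\<Sum>n\<in>I. decay (n - n0)))"
        unfolding sum_product by (simp add: sum_distrib_left)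
      also have "\<dots> \<le> 60000 * (decay_sum N * decay_sum N)"
        using mn sum_decay_shift_le[of m0 N] sum_decay_shift_le[of n0 N] decay_pos one_le_decay_sum[of N]
        by (intro mult_left_mono mult_mono sum_nonneg) (auto simp: I_def abs_le_iff less_imp_le)
      finally show ?thesis by (simp add: power2_eq_square)
    qed
    then have "norm (\<kappa> * (R z - p)) \<le> 60000 * (decay_sum N)\<^sup>2"
      using mult_mono[OF \<kappa>, of "norm (R z - p)"] by (simp add: norm_mult)
    ultimately have "norm ((F z - (Im (w z) + N) - \<kappa> * p) - \<kappa> * (R z - p)) \<le> C + 2 * decay_sum N + 60000 * (decay_sum N)\<^sup>2"
      using norm_triangle_ineq4[of "F z - (Im (w z) + N) - \<kappa> * p" "\<kappa> * (R z - p)"] by linarith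
    also have "\<dots> \<le> C * (decay_sum N)\<^sup>2 + 2 * (decay_sum N)\<^sup>2 + 60000 * (decay_sum N)\<^sup>2"
    proof -
      have "1 \<le> (decay_sum N)\<^sup>2" "decay_sum N \<le> (decay_sum N)\<^sup>2"
        using one_le_decay_sum[of N] by (auto simp: power2_eq_square mult_le_cancel_left1 intro: order_trans)
      then show ?thesis using C(1) mult_left_mono[of 1 "(decay_sum N)\<^sup>2" C] by linarith
    qed
    also have "\<dots> = C' * (decay_sum N)\<^sup>2" by (simp add: C'_def algebra_simps)
    finally have le: "norm ((F z - (Im (w z) + N) - \<kappa> * p) - \<kappa> * (R z - p)) \<le> C' * (decay_sum N)\<^sup>2" .
    have "Im z = \<delta> * (Im (w z) + Im t)" using \<delta> by (simp add: w_def)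
    then have "complex_of_real (Im z) = \<delta> * (Im (w z) + Im t)" by (simp only:)
    then have "P z - Im z = \<delta> * ((F z - (Im (w z) + N) - \<kappa> * p) - \<kappa> * (R z - p))"
      using \<delta> by (simp add: P_def algebra_simps)
    then have "norm (of_real (Im z) - P z) = \<delta> * norm ((F z - (Im (w z) + N) - \<kappa> * p) - \<kappa> * (R z - p))"
      using \<delta> by (metis abs_of_pos norm_minus_commute norm_mult norm_of_real)
    also have "\<dots> \<le> \<delta> * (C' * (decay_sum N)\<^sup>2)"
      using le \<delta> by (intro mult_left_mono) auto
    also have "\<dots> < e" using N(2) by (simp add: \<delta>_def)
    finally show ?thesis .
  qed
  ultimately show "\<exists>g\<in>poly_closure K. \<forall>z\<in>K. norm (of_real (Im z) - g z) < e" by blast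
qed

text \<open>The real functions approximable on \<open>K\<close> form an algebra containing
  \<open>Im\<close>, and also \<open>Re\<close> because Re z = z - \<i> Im z. These two separate
  points, so the real Stone-Weierstrass theorem applies to both parts of \<open>f\<close>.\<close>

lemma Lavrentiev:
  assumes K: "compact K" "connected (- K)" and int: "interior K = {}" and f: "continuous_on K f"
  shows "f \<in> poly_closure K"
proof -
  define R where "R = {g :: complex \<Rightarrow> real. continuous_on K g \<and> (\<lambda>z. of_real (g z)) \<in> poly_closure K}"
  have Im: "Im \<in> R"
    using Im_in_poly_closure[OF K int] by (auto simp: R_def intro: continuous_intros)
  have "(\<lambda>z. z - \<i> * of_real (Im z)) \<in> poly_closure K"
    by (intro poly_closure_diff poly_closure_cmult ident_in_poly_closure Im_in_poly_closure K int)
  then have "(\<lambda>z. of_real (Re z)) \<in> poly_closure K"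
    by (rule poly_closure_cong) (simp add: complex_eq_iff)
  then have Re: "Re \<in> R"
    by (auto simp: R_def intro: continuous_intros)
  interpret function_ring_on R K
  proof
    show "\<exists>f\<in>R. f x \<noteq> f y" if "x \<in> K" "y \<in> K" "x \<noteq> y" for x y
      using that Re Im by (metis complex_eqI)
  qed (auto simp: R_def K intro: continuous_intros poly_closure_add poly_closure_mult const_in_poly_closure)
  have real: "(\<lambda>z. of_real (g z)) \<in> poly_closure K" if g: "continuous_on K g" for g
  proof (rule poly_closure_limit)
    fix e :: real assume "e > 0"
    then obtain h where h: "h \<in> R" "\<forall>x\<in>K. \<bar>g x - h x\<bar> < e"
      using Stone_Weierstrass_basic[OF g] by blast
    moreover have "norm (complex_of_real (g z) - of_real (h z)) = \<bar>g z - h z\<bar>" for z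
      by (metis norm_of_real of_real_diff)
    ultimately show "\<exists>h\<in>poly_closure K. \<forall>z\<in>K. norm (of_real (g z) - h z) < e"
      by (auto simp: R_def intro!: bexI[of _ "\<lambda>z. of_real (h z)"])
  qed
  have "(\<lambda>z. of_real (Re (f z)) + \<i> * of_real (Im (f z))) \<in> poly_closure K"
    by (intro poly_closure_add poly_closure_cmult K real continuous_intros f)
  then show ?thesis by (rule poly_closure_cong) (simp add: complex_eq_iff)
qed

section \<open>Necessity\<close>

lemma holomorphic_on_poly: "poly p holomorphic_on S"
  unfolding holomorphic_on_def field_differentiable_def
  using has_field_derivative_at_within[OF poly_DERIV] by blast

text \<open>Conjugation is its own real derivative and is not complex linear.\<close>

lemma not_field_differentiable_cnj: "\<not> cnj field_differentiable at a"
proof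
  assume "cnj field_differentiable at a"
  then obtain d where "(cnj has_derivative (*) d) (at a)"
    by (auto simp: field_differentiable_def has_field_derivative_def)
  moreover have "(cnj has_derivative cnj) (at a)"
    by (rule bounded_linear.has_derivative[OF bounded_linear_cnj has_derivative_ident])
  ultimately have "(*) d = cnj" by (rule has_derivative_unique)
  then have "d * 1 = cnj 1" "d * \<i> = cnj \<i>" by metis+
  then show False by simp
qed

text \<open>On a disc inside \<open>L\<close>, \<open>cnj\<close> would be a uniform limit of
  polynomials and therefore holomorphic.\<close>

lemma interior_empty_if_all_continuous_in_poly_closure:
  assumes "\<And>f. continuous_on L f \<Longrightarrow> f \<in> poly_closure L"
  shows "interior L = {}"
proof (rule ccontr)
  assume "interior L \<noteq> {}"
  then obtain a r where r: "r > 0" "cball a r \<subseteq> L"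
    by (metis ex_in_conv mem_interior_cball)
  have "cnj \<in> poly_closure L" by (intro assms continuous_intros)
  then have "\<exists>p. \<forall>z\<in>L. norm (cnj z - poly p z) < inverse (Suc n)" for n
    unfolding poly_closure_def by simp
  then obtain p where p: "\<And>n z. z \<in> L \<Longrightarrow> norm (cnj z - poly (p n) z) < inverse (Suc n)" by metis
  have "uniform_limit (cball a r) (\<lambda>n. poly (p n)) cnj sequentially"
  proof (rule uniform_limitI)
    fix e :: real assume "e > 0"
    then have "\<forall>\<^sub>F n in sequentially. inverse (real (Suc n)) < e"
      using LIMSEQ_inverse_real_of_nat by (rule order_tendstoD(2)[rotated])
    then show "\<forall>\<^sub>F n in sequentially. \<forall>z\<in>cball a r. dist (poly (p n) z) (cnj z) < e"
    proof eventually_elim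
      case (elim n)
      show ?case
      proof
        fix z assume "z \<in> cball a r"
        then show "dist (poly (p n) z) (cnj z) < e"
          using p[of z n] r(2) elim by (auto simp: dist_norm norm_minus_commute)
      qed
    qed
  qed
  moreover have "\<forall>\<^sub>F n in sequentially. continuous_on (cball a r) (poly (p n)) \<and> poly (p n) holomorphic_on ball a r"
    by (intro always_eventually allI conjI continuous_intros holomorphic_on_poly)
  ultimately have "cnj holomorphic_on ball a r"
    using holomorphic_uniform_limit[of a r "\<lambda>n. poly (p n)" sequentially cnj] by auto
  then have "cnj field_differentiable at a"
    using r(1) by (auto intro: holomorphic_on_imp_differentiable_at)
  then show False
    using not_field_differentiable_cnj by blast
qed

text \<open>A bounded component \<open>C\<close> of the complement is excluded by the maximum principle: if \<open>p\<close> is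
  close to \<open>1 / (z - a)\<close> on \<open>L\<close>, then \<open>p(z) (z - a) - 1\<close> is small on the frontier of \<open>C\<close>, but
  not at the point \<open>a\<close> of \<open>C\<close>.\<close>
lemma connected_Compl_if_all_continuous_in_poly_closure:
  assumes L: "compact L" and all: "\<And>f. continuous_on L f \<Longrightarrow> f \<in> poly_closure L"
  shows "connected (- L)"
proof (rule ccontr)
  assume "\<not> connected (- L)"
  then obtain C where C: "C \<in> components (- L)" "bounded C"
    using cobounded_has_bounded_component[of "- L"] L
    by (auto simp: compact_imp_bounded)
  then obtain a where a: "a \<in> C" using in_components_nonempty by blast
  have "a \<notin> L" using a C(1) in_components_subset by blast
  have "open C" using C(1) L by (meson compact_imp_closed open_Compl open_components)
  have fr: "frontier C \<subseteq> L"
    using C(1) L by (metis closed_Compl compact_imp_closed frontier_of_components_closed_complement)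
  obtain B where B: "B > 0" "\<And>z. z \<in> L \<Longrightarrow> norm (z - a) \<le> B"
  proof -
    have "bounded ((\<lambda>z. z - a) ` L)"
      by (intro compact_imp_bounded compact_continuous_image L continuous_intros)
    then show ?thesis using that by (auto simp: bounded_pos)
  qed
  have "(\<lambda>z. 1 / (z - a)) \<in> poly_closure L"
    using \<open>a \<notin> L\<close> by (intro all continuous_intros) auto
  \<comment> \<open>The tolerance gives |f| <= 1/2 on the frontier, whereas f a = -1.\<close>
  then obtain p where p: "\<And>z. z \<in> L \<Longrightarrow> norm (1 / (z - a) - poly p z) < 1 / (2 * B)"
    using poly_closureE[of _ L "1 / (2 * B)"] B(1) by auto
  define f where "f z = poly p z * (z - a) - 1" for z
  have "norm (f a) \<le> 1 / 2"
  proof (rule maximum_modulus_frontier[of f C])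
    show "norm (f z) \<le> 1 / 2" if "z \<in> frontier C" for z
    proof -
      have z: "z \<in> L" "z \<noteq> a" using that fr \<open>a \<notin> L\<close> by auto
      have "f z = - ((1 / (z - a) - poly p z) * (z - a))"
        using z by (simp add: f_def algebra_simps)
      then have "norm (f z) = norm (1 / (z - a) - poly p z) * norm (z - a)"
        by (simp add: norm_mult)
      also have "\<dots> \<le> 1 / (2 * B) * B"
        using p[OF z(1)] B(1) B(2)[OF z(1)] by (intro mult_mono) auto
      finally show ?thesis using B(1) by simp
    qed
    show "f holomorphic_on interior C" "continuous_on (closure C) f"
      unfolding f_def by (intro holomorphic_intros continuous_intros holomorphic_on_poly)+
  qed (use C a in auto)
  then show False by (simp add: f_def)
qed

section \<open>Passage between \<open>K\<close> and its image under \<open>\<phi>\<close>\<close>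

theorem theorem1p1:
  fixes K :: "complex set" and \<phi> :: "complex \<Rightarrow> complex"
  assumes "compact K" and "\<phi> \<in> mspace (CK K)"
  shows "mspace (CK K) = closed_subalgebra_gen K \<phi> \<longleftrightarrow>
    homeomorphic_map (top_of_set K) (top_of_set (\<phi> ` K)) \<phi> \<and>
    interior K = {} \<and> connected (- K)"
proof -
  let ?L = "\<phi> ` K"
  have cont: "continuous_on K \<phi>"
    using assms by (simp add: mspace_CK)
  then have L: "compact ?L" using assms(1) by (rule compact_continuous_image)
  have gen: "mspace (CK K) = closed_subalgebra_gen K \<phi> \<longleftrightarrow>
    (\<forall>f. continuous_on K f \<longrightarrow> (\<forall>e>0. \<exists>p. \<forall>x\<in>K. norm (f x - poly p (\<phi> x)) < e))" (is "?gen \<longleftrightarrow> ?dense")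
  proof
    assume ?gen
    show ?dense
    proof (intro allI impI)
      fix f :: "complex \<Rightarrow> complex" and e :: real assume f: "continuous_on K f" and e: "e > 0"
      have "restrict f K \<in> mspace (CK K)"
        using f assms(1) by (simp add: mspace_CK)
      then have "restrict f K \<in> closed_subalgebra_gen K \<phi>" using \<open>?gen\<close> by simp
      then show "\<exists>p. \<forall>x\<in>K. norm (f x - poly p (\<phi> x)) < e"
        using e unfolding closed_subalgebra_gen_iff[OF assms] by simp
    qed
  next
    assume ?dense
    show ?gen
    proof (intro equalityI subsetI)
      fix f assume f: "f \<in> mspace (CK K)"
      then have "continuous_on K f" using assms(1) by (simp add: mspace_CK)
      then show "f \<in> closed_subalgebra_gen K \<phi>"
        using \<open>?dense\<close> f by (simp only: closed_subalgebra_gen_iff[OF assms]) blast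
    qed (simp only: closed_subalgebra_gen_iff[OF assms])
  qed
  have homeo: "homeomorphic_map (top_of_set K) (top_of_set ?L) \<phi> \<longleftrightarrow> inj_on \<phi> K"
  proof
    assume "inj_on \<phi> K"
    then obtain \<psi> where "homeomorphism K ?L \<phi> \<psi>"
      using homeomorphism_compact[OF assms(1) cont refl] by blast
    then have "homeomorphic_maps (top_of_set K) (top_of_set ?L) \<phi> \<psi>"
      by (auto simp: homeomorphism_def homeomorphic_maps_def)
    then show "homeomorphic_map (top_of_set K) (top_of_set ?L) \<phi>"
      by (auto simp: homeomorphic_map_maps)
  next
    assume "homeomorphic_map (top_of_set K) (top_of_set ?L) \<phi>"
    then show "inj_on \<phi> K" using homeomorphic_imp_injective_map by fastforce
  qed
  \<comment> \<open>Empty interior is preserved by invariance of domain. Connectedness of the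
    complement is a homotopy invariant of compact plane sets.\<close>
  have transfer: "interior ?L = {} \<longleftrightarrow> interior K = {}" "connected (- ?L) \<longleftrightarrow> connected (- K)" if "inj_on \<phi> K"
  proof -
    have "K homeomorphic ?L"
      using homeomorphic_compact[OF assms(1) cont refl that] .
    then show "connected (- ?L) \<longleftrightarrow> connected (- K)"
      using homotopy_eqv_separation[OF homeomorphic_imp_homotopy_eqv assms(1) L] by simp
    show "interior ?L = {} \<longleftrightarrow> interior K = {}"
      using homeomorphic_interiors_same_dimension[OF \<open>K homeomorphic ?L\<close> refl]
      by (auto simp: homeomorphic_empty)
  qed
  have dense: "?dense \<longleftrightarrow> inj_on \<phi> K \<and> interior ?L = {} \<and> connected (- ?L)"
  proof
    assume ?dense
    have all: "g \<in> poly_closure ?L" if "continuous_on ?L g" for g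
    proof -
      have "continuous_on K (g \<circ> \<phi>)"
        by (intro continuous_on_compose cont that)
      then show ?thesis
        using \<open>?dense\<close> by (auto simp: poly_closure_def)
    qed
    have "inj_on \<phi> K"
    proof (rule inj_onI)
      fix x y assume xy: "x \<in> K" "y \<in> K" "\<phi> x = \<phi> y"
      show "x = y"
      proof (rule ccontr)
        assume "x \<noteq> y"
        then have "norm (x - y) / 2 > 0" by simp
        \<comment> \<open>Approximating the identity forces injectivity: one value p(\<phi> x) =
          p(\<phi> y) cannot be closer than |x - y|/2 to both points.\<close>
        then obtain p where "\<forall>z\<in>K. norm (z - poly p (\<phi> z)) < norm (x - y) / 2"
          using \<open>?dense\<close> continuous_on_id by metis
        then have "norm (x - poly p (\<phi> x)) < norm (x - y) / 2" "norm (y - poly p (\<phi> x)) < norm (x - y) / 2"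
          using xy by auto
        then show False using norm_triangle_ineq4[of "x - poly p (\<phi> x)" "y - poly p (\<phi> x)"] by simp
      qed
    qed
    then show "inj_on \<phi> K \<and> interior ?L = {} \<and> connected (- ?L)"
      using interior_empty_if_all_continuous_in_poly_closure[OF all]
        connected_Compl_if_all_continuous_in_poly_closure[OF L all] by blast
  next
    assume *: "inj_on \<phi> K \<and> interior ?L = {} \<and> connected (- ?L)"
    show ?dense
    proof (intro allI impI)
      fix f :: "complex \<Rightarrow> complex" and e :: real assume f: "continuous_on K f" and e: "e > 0"
      obtain \<psi> where \<psi>: "continuous_on ?L \<psi>" "\<And>x. x \<in> K \<Longrightarrow> \<psi> (\<phi> x) = x"
        using homeomorphism_compact[OF assms(1) cont refl] * unfolding homeomorphism_def by metis
      have "continuous_on ?L (f \<circ> \<psi>)"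
        using \<psi> f by (intro continuous_on_compose) (auto elim: continuous_on_subset)
      then have "f \<circ> \<psi> \<in> poly_closure ?L"
        using Lavrentiev[OF L] * by blast
      then obtain p where p: "\<And>z. z \<in> ?L \<Longrightarrow> norm ((f \<circ> \<psi>) z - poly p z) < e"
        using poly_closureE e by blast
      have "norm (f x - poly p (\<phi> x)) < e" if "x \<in> K" for x
        using p[of "\<phi> x"] \<psi>(2)[OF that] that by simp
      then show "\<exists>p. \<forall>x\<in>K. norm (f x - poly p (\<phi> x)) < e" by blast
    qed
  qed
  \<comment> \<open>Both sides contain injectivity, under which \<open>transfer\<close> exchanges
    the conditions on the image for those on \<open>K\<close>.\<close>
  show ?thesis unfolding gen dense homeo using transfer by blast
qed

end
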